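(* Let $\sigma\neq 0$ be a real constant. Assume that $\boldsymbol{u}=(u^1,u^2,u^3)$ and $\boldsymbol{h}=(h^1,h^2,h^3)$ are bounded smooth vector fields on $\mathbb{R}^3$ which, together with some smooth scalar function $P$ on $\mathbb{R}^3$, solve the steady MHD system \[ -\Delta \boldsymbol{u} + (\boldsymbol{u}\cdot\nabla)\boldsymbol{u} - (\boldsymbol{h}\cdot\nabla)\boldsymbol{h} + \nabla P = 0,\qquad -\Delta \boldsymbol{h} + (\boldsymbol{u}\cdot\nabla)\boldsymbol{h} - (\boldsymbol{h}\cdot\nabla)\boldsymbol{u} = 0,\qquad \nabla\cdot\boldsymbol{u} = \nabla\cdot\boldsymbol{h} = 0 \] in $\mathbb{R}^3$, and assume that $\boldsymbol{u}$ and $\boldsymbol{h}$ are helically symmetric with pitch $\sigma$. Then $\boldsymbol{u}$ and $\boldsymbol{h}$ are constant vectors of the form $\boldsymbol{u}=(0,0,C_1)$ and $\boldsymbol{h}=(0,0,C_2)$ for some constants $C_1,C_2\in\mathbb{R}$.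
   Context: For $\rho\in\mathbb{R}$ let $R_\rho$ be the matrix with rows $(\cos\rho,\ \sin\rho,\ 0)$, $(-\sin\rho,\ \cos\rho,\ 0)$, $(0,\ 0,\ 1)$, and define $S_\rho:\mathbb{R}^3\to\mathbb{R}^3$ by $S_\rho(\boldsymbol{x}) = R_\rho \boldsymbol{x} + (0,0,\sigma\rho)^T$. A vector field $\boldsymbol{v}$ on $\mathbb{R}^3$ is called helically symmetric with pitch $\sigma$ if $\boldsymbol{v}(S_\rho(\boldsymbol{x})) = R_\rho \boldsymbol{v}(\boldsymbol{x})$ for all $\rho\in\mathbb{R}$ and all $\boldsymbol{x}\in\mathbb{R}^3$. *)

theory Defs
  imports "HOL-Analysis.Analysis"
begin

definition partial :: "3 \<Rightarrow> (real^3 \<Rightarrow> 'b::real_normed_vector) \<Rightarrow> real^3 \<Rightarrow> 'b" where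
  "partial i f x = frechet_derivative f (at x) (axis i 1)"

fun Ck :: "nat \<Rightarrow> (real^3 \<Rightarrow> 'b::real_normed_vector) \<Rightarrow> bool" where
  "Ck 0 f = continuous_on UNIV f"
| "Ck (Suc k) f = ((\<forall>x. f differentiable (at x)) \<and> (\<forall>i. Ck k (partial i f)))"

definition smooth :: "(real^3 \<Rightarrow> 'b::real_normed_vector) \<Rightarrow> bool" where
  "smooth f = (\<forall>k. Ck k f)"

definition laplacian :: "(real^3 \<Rightarrow> 'b::real_normed_vector) \<Rightarrow> real^3 \<Rightarrow> 'b" where
  "laplacian f x = (\<Sum>i\<in>UNIV. partial i (partial i f) x)"

definition advect :: "(real^3 \<Rightarrow> real^3) \<Rightarrow> (real^3 \<Rightarrow> real^3) \<Rightarrow> real^3 \<Rightarrow> real^3" where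
  "advect v w x = (\<Sum>j\<in>UNIV. (v x $ j) *\<^sub>R partial j w x)"

definition grad :: "(real^3 \<Rightarrow> real) \<Rightarrow> real^3 \<Rightarrow> real^3" where
  "grad P x = (\<chi> i. partial i P x)"

definition div3 :: "(real^3 \<Rightarrow> real^3) \<Rightarrow> real^3 \<Rightarrow> real" where
  "div3 v x = (\<Sum>i\<in>UNIV. partial i (\<lambda>y. v y $ i) x)"

definition rotR :: "real \<Rightarrow> real^3^3" where
  "rotR \<rho> = vector [vector [cos \<rho>, sin \<rho>, 0], vector [- sin \<rho>, cos \<rho>, 0], vector [0, 0, 1]]"

definition helS :: "real \<Rightarrow> real \<Rightarrow> real^3 \<Rightarrow> real^3" where
  "helS \<sigma> \<rho> x = rotR \<rho> *v x + vector [0, 0, \<sigma> * \<rho>]"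

definition helically_symmetric :: "real \<Rightarrow> (real^3 \<Rightarrow> real^3) \<Rightarrow> bool" where
  "helically_symmetric \<sigma> v = (\<forall>\<rho> x. v (helS \<sigma> \<rho> x) = rotR \<rho> *v v x)"

end

theory Submission
  imports Defs
begin

text \<open>
  Helically symmetric fields are determined by their values on the plane \<open>z = 0\<close>, and there
  the axial derivative of an invariant scalar is \<open>1/\<sigma>\<close> times its angular derivative. Hence the
  flux of an equivariant field through circles obeys a one-dimensional divergence theorem, and a
  divergence-free field has a radial component of mean zero on each circle which is therefore
  controlled by the circular mean of \<open>\<bar>\<nabla>u\<bar>\<close>; this gains the decay that mere boundedness does not give.

  The pressure is periodic along the helix, for otherwise the mean axial velocity would grow
  quadratically. Writing the radial velocity as the angular derivative of a stream function
  \<open>\<psi>\<close> and integrating by parts, the pressure flux becomes a flux of \<open>\<partial>\<^sub>zP\<close>, which the third momentum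
  equation expresses as a divergence, while \<open>\<nabla>\<psi>\<close> only involves \<open>u\<close>. With \<open>E(r)\<close> the Dirichlet
  energy in the disc of radius \<open>r\<close>, all this gives \<open>r E = \<kappa> + g'\<close> where \<open>\<kappa>\<close> and \<open>g\<close> are at most
  \<open>C r\<^sup>2\<close> times the circular mean of the gradient. Testing against a cutoff on \<open>[R, 2R]\<close> shows first
  that \<open>E\<close> is bounded, then that it vanishes.
\<close>

text \<open>The hypotheses bound only the fields. Hence \<open>P\<close> has to be eliminated
  exactly rather than estimated, and derivatives may enter an estimate only through
  \<open>circ_grad\<close>, the circular integral of the gradient norm. The energy balance comes
  from testing the momentum equation with \<open>u\<close> and the induction equation with
  \<open>h\<close>. Each quadratic term of its flux through a circle contains the radial component
  of \<open>u\<close> or of \<open>h\<close>, which is where the mean-zero bound enters. The factor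
  r in front of E is forced: the axial flux identity produces the pressure term as r times a
  circular integral. After averaging over [R, 2R] all terms have the same order in R, so scaling
  supplies no small factor; what remains is E + I \<le> K (t I + 2/t) with t free, and t has to be
  chosen twice. The gradient of \<open>P\<close> is equivariant because the momentum equation
  expresses it through \<open>u\<close> and \<open>h\<close>; so \<open>P\<close> changes at one
  common constant rate \<open>c\<close> along all helices. At the end the motions carry the
  vanishing of the gradients from the plane to all of space, and the half turn removes the
  horizontal components of the constant fields.\<close>

section \<open>Partial derivatives\<close>

lemma partial_eqI:
  assumes "(f has_derivative f') (at x)"
  shows "partial i f x = f' (axis i 1)"
  using frechet_derivative_at[OF assms] by (simp add: partial_def)

lemma has_derivative_partial:
  fixes f :: "real^3 \<Rightarrow> 'b::real_normed_vector"
  assumes "f differentiable (at x)"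
  shows "(f has_derivative (\<lambda>v. \<Sum>i\<in>UNIV. v $ i *\<^sub>R partial i f x)) (at x)"
proof -
  let ?D = "frechet_derivative f (at x)"
  have D: "(f has_derivative ?D) (at x)"
    using assms by (simp add: frechet_derivative_works)
  then have lin: "linear ?D"
    by (rule has_derivative_linear)
  have "?D v = (\<Sum>i\<in>UNIV. v $ i *\<^sub>R partial i f x)" for v
  proof -
    have "?D v = ?D (\<Sum>i\<in>UNIV. v $ i *\<^sub>R axis i 1)"
      using basis_expansion[of v] by (simp add: scalar_mult_eq_scaleR)
    also have "\<dots> = (\<Sum>i\<in>UNIV. v $ i *\<^sub>R partial i f x)"
      by (simp add: linear_sum[OF lin] linear_cmul[OF lin] partial_def)
    finally show ?thesis .
  qed
  then show ?thesis
    using D by (metis (no_types, lifting) ext)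
qed

lemma partial_const [simp]: "partial i (\<lambda>x. c) = (\<lambda>x. 0)"
  by (rule ext, subst partial_eqI[OF has_derivative_const]) simp

lemma partial_add:
  assumes "f differentiable (at x)" "g differentiable (at x)"
  shows "partial i (\<lambda>x. f x + g x) x = partial i f x + partial i g x"
  using assms unfolding frechet_derivative_works
  by (subst partial_eqI[OF has_derivative_add]) (auto simp: partial_def)

lemma partial_minus:
  assumes "f differentiable (at x)"
  shows "partial i (\<lambda>x. - f x) x = - partial i f x"
  using assms unfolding frechet_derivative_works
  by (subst partial_eqI[OF has_derivative_minus]) (auto simp: partial_def)

lemma partial_diff:
  assumes "f differentiable (at x)" "g differentiable (at x)"
  shows "partial i (\<lambda>x. f x - g x) x = partial i f x - partial i g x"
  using assms unfolding frechet_derivative_works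
  by (subst partial_eqI[OF has_derivative_diff]) (auto simp: partial_def)

lemma partial_mult:
  fixes f g :: "real^3 \<Rightarrow> real"
  assumes "f differentiable (at x)" "g differentiable (at x)"
  shows "partial i (\<lambda>x. f x * g x) x = f x * partial i g x + partial i f x * g x"
  using assms unfolding frechet_derivative_works
  by (subst partial_eqI[OF has_derivative_mult]) (auto simp: partial_def)

lemma partial_component:
  fixes f :: "real^3 \<Rightarrow> real^3"
  assumes "f differentiable (at x)"
  shows "partial i (\<lambda>x. f x $ j) x = partial i f x $ j"
  using assms unfolding frechet_derivative_works
  by (subst partial_eqI[OF bounded_linear.has_derivative[OF bounded_linear_vec_nth]])
    (auto simp: partial_def)

lemma Ck_differentiable: "Ck (Suc k) f \<Longrightarrow> f differentiable (at x)"
  by simp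

lemma Ck_SucD: "Ck (Suc k) f \<Longrightarrow> Ck k f"
proof (induction k arbitrary: f)
  case 0
  then show ?case
    by (auto intro!: differentiable_imp_continuous_on simp: differentiable_on_def
        intro: differentiable_at_withinI)
next
  case (Suc k)
  then show ?case
    using Ck.simps(2) by blast
qed

lemma Ck_mono: "k \<le> l \<Longrightarrow> Ck l f \<Longrightarrow> Ck k f"
  by (induction l) (metis le_zero_eq, metis Ck_SucD le_SucE)

lemma Ck_const: "Ck k (\<lambda>x. c)"
  by (induction k arbitrary: c) auto

lemma Ck_add:
  assumes "Ck k f" "Ck k g"
  shows "Ck k (\<lambda>x. f x + g x)"
  using assms
proof (induction k arbitrary: f g)
  case (Suc k)
  then have "partial i (\<lambda>x. f x + g x) = (\<lambda>x. partial i f x + partial i g x)" for i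
    by (auto simp: partial_add)
  with Suc show ?case by (auto intro!: differentiable_add)
qed (auto intro: continuous_intros)

lemma Ck_minus:
  assumes "Ck k f"
  shows "Ck k (\<lambda>x. - f x)"
  using assms
proof (induction k arbitrary: f)
  case (Suc k)
  then have "partial i (\<lambda>x. - f x) = (\<lambda>x. - partial i f x)" for i
    by (auto simp: partial_minus)
  with Suc show ?case by (auto intro!: differentiable_minus)
qed (auto intro: continuous_intros)

lemma Ck_diff: "Ck k f \<Longrightarrow> Ck k g \<Longrightarrow> Ck k (\<lambda>x. f x - g x)"
  using Ck_add[of k f "\<lambda>x. - g x"] Ck_minus[of k g] by simp

lemma Ck_mult:
  fixes f g :: "real^3 \<Rightarrow> real"
  assumes "Ck k f" "Ck k g"
  shows "Ck k (\<lambda>x. f x * g x)"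
  using assms
proof (induction k arbitrary: f g)
  case (Suc k)
  then have "partial i (\<lambda>x. f x * g x) = (\<lambda>x. f x * partial i g x + partial i f x * g x)" for i
    by (auto simp: partial_mult)
  moreover have "Ck k f" "Ck k g"
    using Suc.prems Ck_SucD by blast+
  ultimately show ?case
    using Suc by (auto intro!: Ck_add differentiable_mult)
qed (auto intro: continuous_intros)

lemma Ck_component:
  fixes f :: "real^3 \<Rightarrow> real^3"
  assumes "Ck k f"
  shows "Ck k (\<lambda>x. f x $ j)"
  using assms
proof (induction k arbitrary: f)
  case (Suc k)
  then have "partial i (\<lambda>x. f x $ j) = (\<lambda>x. partial i f x $ j)" for i
    by (auto simp: partial_component)
  moreover have "(\<lambda>x. f x $ j) differentiable (at x)" for x
    using Suc.prems bounded_linear.has_derivative[OF bounded_linear_vec_nth]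
    unfolding Ck.simps differentiable_def by blast
  ultimately show ?case
    using Suc by auto
qed (auto intro: continuous_intros)

lemma Ck_partial: "Ck (Suc k) f \<Longrightarrow> Ck k (partial i f)"
  by simp

lemma Ck_continuous_on: "Ck k f \<Longrightarrow> continuous_on S f"
  using Ck_mono[of 0 k f] continuous_on_subset[of UNIV f S] by simp

section \<open>Circular means\<close>

text \<open>Both arguments range over all reals. Derivatives in \<open>r\<close> are therefore
  two-sided at 0 as well, and quantities constant in \<open>r\<close> can be evaluated at 0, where
  every \<open>rad F\<close> vanishes.\<close>

definition polar :: "real \<Rightarrow> real \<Rightarrow> real^3" where
  "polar r t = (r * cos t) *\<^sub>R axis 1 1 + (r * sin t) *\<^sub>R axis 2 1"

lemma polar_nth [simp]:
  "polar r t $ 1 = r * cos t" "polar r t $ 2 = r * sin t" "polar r t $ 3 = 0"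
  by (auto simp: polar_def axis_def)

lemma polar_zero [simp]: "polar 0 t = 0"
  by (simp add: polar_def)

lemma polar_2pi [simp]: "polar r (2 * pi) = polar r 0"
  by (simp add: polar_def)

lemma continuous_on_polar [continuous_intros]:
  fixes f g :: "'a::t2_space \<Rightarrow> real"
  assumes "continuous_on A f" "continuous_on A g"
  shows "continuous_on A (\<lambda>x. polar (f x) (g x))"
  unfolding polar_def using assms by (intro continuous_intros)

lemma continuous_on_comp_polar:
  fixes f g :: "'a::t2_space \<Rightarrow> real"
  assumes "continuous_on UNIV F" "continuous_on A f" "continuous_on A g"
  shows "continuous_on A (\<lambda>x. F (polar (f x) (g x)))"
  by (rule continuous_on_compose2[OF assms(1)]) (auto intro!: continuous_intros assms)

lemma polar_deriv_radial:
  fixes f :: "real^3 \<Rightarrow> real"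
  assumes "f differentiable (at (polar r t))"
  shows "((\<lambda>r. f (polar r t)) has_real_derivative
    cos t * partial 1 f (polar r t) + sin t * partial 2 f (polar r t)) (at r)"
proof -
  have X: "((\<lambda>r. polar r t) has_derivative
      (\<lambda>s. (s * cos t) *\<^sub>R axis 1 1 + (s * sin t) *\<^sub>R axis 2 1)) (at r)"
    unfolding polar_def by (auto intro!: derivative_eq_intros)
  show ?thesis
    using has_derivative_compose[OF X has_derivative_partial[OF assms]]
    by (auto simp: has_field_derivative_def o_def sum_3 axis_def algebra_simps
        elim!: has_derivative_eq_rhs)
qed

lemma polar_deriv_angular:
  fixes f :: "real^3 \<Rightarrow> real"
  assumes "f differentiable (at (polar r t))"
  shows "((\<lambda>t. f (polar r t)) has_real_derivative
    r * (cos t * partial 2 f (polar r t) - sin t * partial 1 f (polar r t))) (at t)"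
proof -
  have X: "((\<lambda>t. polar r t) has_derivative
      (\<lambda>s. (- s * (r * sin t)) *\<^sub>R axis 1 1 + (s * (r * cos t)) *\<^sub>R axis 2 1)) (at t)"
    unfolding polar_def by (auto intro!: derivative_eq_intros ext simp: mult_ac)
  show ?thesis
    using has_derivative_compose[OF X has_derivative_partial[OF assms]]
    by (auto simp: has_field_derivative_def o_def sum_3 axis_def algebra_simps
        elim!: has_derivative_eq_rhs)
qed

lemma continuous_on_polar_pair:
  assumes "Ck k F"
  shows "continuous_on UNIV (\<lambda>p. F (polar (fst p) (snd p)))"
  by (intro continuous_on_comp_polar Ck_continuous_on[OF assms] continuous_intros)

text \<open>Neither normalised nor weighted by arc length: the factor r of the line element is part
  of \<open>rad\<close>. The integrand depends on \<open>r\<close> too, so that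
  \<open>circ g\<close> can be differentiated in the radius.\<close>

definition circ :: "(real \<Rightarrow> real \<Rightarrow> real) \<Rightarrow> real \<Rightarrow> real" where
  "circ g r = integral {0..2*pi} (g r)"

lemma continuous_on_section:
  assumes "continuous_on UNIV (\<lambda>p. g (fst p) (snd p))"
  shows "continuous_on A (g r)"
  using continuous_on_compose2[OF assms, of A "\<lambda>t. (r, t)"]
  by (simp add: continuous_on_Pair)

lemma integrable_section:
  fixes g :: "real \<Rightarrow> real \<Rightarrow> real"
  assumes "continuous_on UNIV (\<lambda>p. g (fst p) (snd p))"
  shows "g r integrable_on {a..b}"
  using continuous_on_section[OF assms] by (rule integrable_continuous_real)

lemma integral_param_deriv:
  fixes g g' :: "real \<Rightarrow> real \<Rightarrow> real"
  assumes "\<And>r t. ((\<lambda>r. g r t) has_real_derivative g' r t) (at r)"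
    and "continuous_on UNIV (\<lambda>p. g (fst p) (snd p))"
    and "continuous_on UNIV (\<lambda>p. g' (fst p) (snd p))"
  shows "((\<lambda>r. integral {a..b} (g r)) has_real_derivative integral {a..b} (g' r)) (at r)"
  using leibniz_rule_field_derivative[of UNIV a b g g' r] assms integrable_section[OF assms(2)]
    continuous_on_subset[OF assms(3)]
  by (simp add: split_beta')

lemma continuous_on_integral_param:
  fixes g :: "real \<Rightarrow> real \<Rightarrow> real"
  assumes "continuous_on UNIV (\<lambda>p. g (fst p) (snd p))"
  shows "continuous_on A (\<lambda>r. integral {a..b} (g r))"
  using integral_continuous_on_param[of A a b g] continuous_on_subset[OF assms]
  by (simp add: split_beta')

lemma circ_deriv:
  fixes g g' :: "real \<Rightarrow> real \<Rightarrow> real"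
  assumes "\<And>r t. ((\<lambda>r. g r t) has_real_derivative g' r t) (at r)"
    and "continuous_on UNIV (\<lambda>p. g (fst p) (snd p))"
    and "continuous_on UNIV (\<lambda>p. g' (fst p) (snd p))"
  shows "(circ g has_real_derivative circ g' r) (at r)"
  unfolding circ_def[abs_def] by (rule integral_param_deriv[OF assms])

lemma continuous_circ:
  assumes "continuous_on UNIV (\<lambda>p. g (fst p) (snd p))"
  shows "continuous_on A (circ g)"
  unfolding circ_def[abs_def] by (rule continuous_on_integral_param[OF assms])

text \<open>Angular integration by parts without boundary term, used with products for
  \<open>g\<close>.\<close>

lemma circ_integral_deriv_eq_0:
  assumes "\<And>t. ((\<lambda>t. g r t) has_real_derivative g' r t) (at t)" "g r (2 * pi) = g r 0"
  shows "circ g' r = 0"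
proof -
  have "(g' r has_integral (g r (2*pi) - g r 0)) {0..2*pi}"
    by (rule fundamental_theorem_of_calculus)
      (auto intro!: has_field_derivative_at_within assms simp: has_real_derivative_iff_has_vector_derivative[symmetric])
  then show ?thesis
    using assms(2) by (simp add: circ_def integral_unique)
qed

lemma integral_abs_le:
  fixes f g :: "real \<Rightarrow> real"
  assumes "f integrable_on S" "g integrable_on S" "\<And>x. x \<in> S \<Longrightarrow> \<bar>f x\<bar> \<le> g x"
  shows "\<bar>integral S f\<bar> \<le> integral S g"
  using integral_norm_bound_integral[of f S g] assms by simp

lemma circ_add:
  assumes "continuous_on UNIV (\<lambda>p. f (fst p) (snd p))" "continuous_on UNIV (\<lambda>p. g (fst p) (snd p))"
  shows "circ (\<lambda>r t. f r t + g r t) r = circ f r + circ g r"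
  unfolding circ_def by (intro integral_add integrable_section assms)

lemma circ_diff:
  assumes "continuous_on UNIV (\<lambda>p. f (fst p) (snd p))" "continuous_on UNIV (\<lambda>p. g (fst p) (snd p))"
  shows "circ (\<lambda>r t. f r t - g r t) r = circ f r - circ g r"
  unfolding circ_def by (intro integral_diff integrable_section assms)

lemma circ_cmult: "circ (\<lambda>r t. c r * f r t) r = c r * circ f r"
  unfolding circ_def by simp

lemma circ_mono:
  assumes "continuous_on UNIV (\<lambda>p. f (fst p) (snd p))" "continuous_on UNIV (\<lambda>p. g (fst p) (snd p))"
    and "\<And>t. t \<in> {0..2*pi} \<Longrightarrow> f r t \<le> g r t"
  shows "circ f r \<le> circ g r"
  unfolding circ_def by (intro integral_le integrable_section assms)

lemma circ_abs_le:
  assumes "continuous_on UNIV (\<lambda>p. f (fst p) (snd p))" "continuous_on UNIV (\<lambda>p. g (fst p) (snd p))"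
    and "\<And>t. t \<in> {0..2*pi} \<Longrightarrow> \<bar>f r t\<bar> \<le> g r t"
  shows "\<bar>circ f r\<bar> \<le> circ g r"
  unfolding circ_def using assms
  by (intro integral_abs_le integrable_section) auto

lemma circ_const [simp]: "circ (\<lambda>r t. c r) r = 2 * pi * c r"
  by (simp add: circ_def)

section \<open>Fluxes through circles\<close>

text \<open>The generator of \<open>\<rho> \<mapsto> helS \<sigma> \<rho>\<close>.\<close>

definition killing :: "real \<Rightarrow> (real^3 \<Rightarrow> real) \<Rightarrow> real^3 \<Rightarrow> real" where
  "killing \<sigma> f x = x $ 2 * partial 1 f x - x $ 1 * partial 2 f x + \<sigma> * partial 3 f x"

text \<open>If \<open>F 3\<close> is invariant, then \<open>\<partial>\<^sub>r (rad F) + \<partial>\<^sub>t (tang \<sigma> F) = r div F\<close> on the plane \<open>z = 0\<close>: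
  the last term of \<open>tang\<close> accounts for \<open>r \<partial>\<^sub>z F\<^sub>3 = (r/\<sigma>) \<partial>\<^sub>t F\<^sub>3\<close>.\<close>

definition rad :: "(3 \<Rightarrow> real^3 \<Rightarrow> real) \<Rightarrow> real \<Rightarrow> real \<Rightarrow> real" where
  "rad F r t = r * (cos t * F 1 (polar r t) + sin t * F 2 (polar r t))"

definition tang :: "real \<Rightarrow> (3 \<Rightarrow> real^3 \<Rightarrow> real) \<Rightarrow> real \<Rightarrow> real \<Rightarrow> real" where
  "tang \<sigma> F r t = cos t * F 2 (polar r t) - sin t * F 1 (polar r t) + r / \<sigma> * F 3 (polar r t)"

definition divg :: "(3 \<Rightarrow> real^3 \<Rightarrow> real) \<Rightarrow> real^3 \<Rightarrow> real" where
  "divg F x = (\<Sum>i\<in>UNIV. partial i (F i) x)"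

text \<open>The angular derivative of \<open>tang \<sigma> F\<close> with \<open>\<sigma>\<close> eliminated by invariance.\<close>

definition tang' :: "(3 \<Rightarrow> real^3 \<Rightarrow> real) \<Rightarrow> real \<Rightarrow> real \<Rightarrow> real" where
  "tang' F r t = - cos t * F 1 (polar r t) - sin t * F 2 (polar r t)
    + r * (sin t * (sin t * partial 1 (F 1) (polar r t) - cos t * partial 2 (F 1) (polar r t))
         + cos t * (cos t * partial 2 (F 2) (polar r t) - sin t * partial 1 (F 2) (polar r t)))
    + r * partial 3 (F 3) (polar r t)"

lemma
  assumes "\<And>j. Ck (Suc k) (F j)"
  shows continuous_rad: "continuous_on UNIV (\<lambda>p. rad F (fst p) (snd p))"
    and continuous_tang: "continuous_on UNIV (\<lambda>p. tang \<sigma> F (fst p) (snd p))"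
    and continuous_tang': "continuous_on UNIV (\<lambda>p. tang' F (fst p) (snd p))"
    and continuous_divg: "continuous_on UNIV (\<lambda>p. divg F (polar (fst p) (snd p)))"
  unfolding rad_def tang_def tang'_def divg_def divide_inverse
  by (intro continuous_intros continuous_on_polar_pair[OF assms]
      continuous_on_polar_pair[OF Ck_partial[OF assms]])+

lemma tang_deriv:
  assumes "\<sigma> \<noteq> 0" and F: "\<And>j. Ck (Suc k) (F j)" and inv: "killing \<sigma> (F 3) (polar r t) = 0"
  shows "(tang \<sigma> F r has_real_derivative tang' F r t) (at t)"
proof -
  note d = polar_deriv_angular[OF Ck_differentiable[OF F]]
  let ?d = "\<lambda>i j. partial i (F j) (polar r t)"
  define q where "q = r / \<sigma>"
  have D: "(tang \<sigma> F r has_real_derivative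
      cos t * (r * (cos t * ?d 2 2 - sin t * ?d 1 2)) - sin t * F 2 (polar r t)
      - (sin t * (r * (cos t * ?d 2 1 - sin t * ?d 1 1)) + cos t * F 1 (polar r t))
      + q * (r * (cos t * ?d 2 3 - sin t * ?d 1 3))) (at t)"
    unfolding tang_def[abs_def] q_def[symmetric]
    by (auto intro!: derivative_eq_intros d)
  have "r * (cos t * ?d 2 3 - sin t * ?d 1 3) = \<sigma> * ?d 3 3"
    using inv by (simp add: killing_def algebra_simps)
  moreover have "\<sigma> * q = r"
    using assms(1) by (simp add: q_def)
  ultimately have "cos t * (r * (cos t * ?d 2 2 - sin t * ?d 1 2)) - sin t * F 2 (polar r t)
      - (sin t * (r * (cos t * ?d 2 1 - sin t * ?d 1 1)) + cos t * F 1 (polar r t))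
      + q * (r * (cos t * ?d 2 3 - sin t * ?d 1 3)) = tang' F r t"
    unfolding tang'_def by algebra
  then show ?thesis using D by simp
qed

text \<open>This is the divergence in polar coordinates: by sin^2 + cos^2 = 1 the horizontal terms
  add up to r times the planar divergence, and the axial term is the last summand of
  \<open>tang'\<close>.\<close>

lemma rad_deriv:
  assumes F: "\<And>j. Ck (Suc k) (F j)"
  shows "((\<lambda>r. rad F r t) has_real_derivative r * divg F (polar r t) - tang' F r t) (at r)"
proof -
  note d = polar_deriv_radial[OF Ck_differentiable[OF F]]
  let ?d = "\<lambda>i j. partial i (F j) (polar r t)"
  have "((\<lambda>r. rad F r t) has_real_derivative cos t * F 1 (polar r t) + sin t * F 2 (polar r t)
      + r * (cos t * (cos t * ?d 1 1 + sin t * ?d 2 1) + sin t * (cos t * ?d 1 2 + sin t * ?d 2 2))) (at r)"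
    unfolding rad_def[abs_def] by (auto intro!: derivative_eq_intros d)
  moreover have "cos t * F 1 (polar r t) + sin t * F 2 (polar r t)
      + r * (cos t * (cos t * ?d 1 1 + sin t * ?d 2 1) + sin t * (cos t * ?d 1 2 + sin t * ?d 2 2))
      = r * divg F (polar r t) - tang' F r t"
    using sin_cos_squared_add[of t] unfolding tang'_def divg_def sum_3 by algebra
  ultimately show ?thesis by simp
qed

text \<open>Divergence theorem against a test function: differentiate under the integral, then move
  the angular derivative from \<open>tang\<close> to \<open>psi\<close> by periodicity. It is
  applied with \<open>psi\<close> equal to 1 and with the stream function.\<close>

lemma weighted_flux_deriv:
  assumes "\<sigma> \<noteq> 0" and F: "\<And>j. Ck (Suc k) (F j)" and inv: "\<And>x. killing \<sigma> (F 3) x = 0"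
    and psi_r: "\<And>r t. ((\<lambda>r. psi r t) has_real_derivative psir r t) (at r)"
    and psi_t: "\<And>r t. (psi r has_real_derivative psit r t) (at t)"
    and per: "\<And>r. psi r (2 * pi) = psi r 0"
    and cont: "continuous_on UNIV (\<lambda>p. psi (fst p) (snd p))"
      "continuous_on UNIV (\<lambda>p. psir (fst p) (snd p))"
      "continuous_on UNIV (\<lambda>p. psit (fst p) (snd p))"
  shows "(circ (\<lambda>r t. psi r t * rad F r t) has_real_derivative
    circ (\<lambda>r t. psir r t * rad F r t + psit r t * tang \<sigma> F r t) r
    + r * circ (\<lambda>r t. psi r t * divg F (polar r t)) r) (at r)"
proof -
  note c = cont continuous_rad[OF F] continuous_tang[OF F] continuous_tang'[OF F] continuous_divg[OF F]
  have "(circ (\<lambda>r t. psi r t * rad F r t) has_real_derivative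
      circ (\<lambda>r t. psir r t * rad F r t + psi r t * (r * divg F (polar r t) - tang' F r t)) r) (at r)"
    by (rule circ_deriv)
      (auto intro!: derivative_eq_intros psi_r rad_deriv[OF F] continuous_intros c)
  moreover
  have tang_per: "tang \<sigma> F r (2 * pi) = tang \<sigma> F r 0"
    by (simp add: tang_def)
  have td: "(tang \<sigma> F r has_real_derivative tang' F r t) (at t)" for t
    by (rule tang_deriv[where k = k], rule assms(1), rule F, rule inv)
  have "circ (\<lambda>r t. psit r t * tang \<sigma> F r t + psi r t * tang' F r t) r = 0"
    by (rule circ_integral_deriv_eq_0[of "\<lambda>r t. psi r t * tang \<sigma> F r t"])
      (auto intro!: derivative_eq_intros psi_t td simp: per tang_per)
  moreover have "circ (\<lambda>r t. psir r t * rad F r t + psi r t * (r * divg F (polar r t) - tang' F r t)) r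
      = circ (\<lambda>r t. ((psir r t * rad F r t + psit r t * tang \<sigma> F r t)
        + r * (psi r t * divg F (polar r t))) - (psit r t * tang \<sigma> F r t + psi r t * tang' F r t)) r"
    by (simp add: algebra_simps)
  moreover have "\<dots> = circ (\<lambda>r t. psir r t * rad F r t + psit r t * tang \<sigma> F r t) r
      + r * circ (\<lambda>r t. psi r t * divg F (polar r t)) r
      - circ (\<lambda>r t. psit r t * tang \<sigma> F r t + psi r t * tang' F r t) r"
    by (subst circ_diff, (intro continuous_intros c)+, subst circ_add, (intro continuous_intros c)+,
        subst circ_cmult, rule refl)
  ultimately show ?thesis by simp
qed

lemma flux_deriv:
  assumes "\<sigma> \<noteq> 0" and F: "\<And>j. Ck (Suc k) (F j)" and inv: "\<And>x. killing \<sigma> (F 3) x = 0"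
  shows "(circ (rad F) has_real_derivative r * circ (\<lambda>r t. divg F (polar r t)) r) (at r)"
  using weighted_flux_deriv[where psi = "\<lambda>r t. 1" and psir = "\<lambda>r t. 0" and psit = "\<lambda>r t. 0"
      and F = F and r = r, OF assms]
  by (simp add: circ_def[abs_def])

section \<open>Invariant scalars and equivariant fields\<close>

lemma killing_add:
  assumes "f differentiable (at x)" "g differentiable (at x)"
  shows "killing \<sigma> (\<lambda>x. f x + g x) x = killing \<sigma> f x + killing \<sigma> g x"
  using assms by (simp add: killing_def partial_add algebra_simps)

lemma killing_diff:
  assumes "f differentiable (at x)" "g differentiable (at x)"
  shows "killing \<sigma> (\<lambda>x. f x - g x) x = killing \<sigma> f x - killing \<sigma> g x"
  using assms by (simp add: killing_def partial_diff algebra_simps)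

lemma killing_mult:
  assumes "f differentiable (at x)" "g differentiable (at x)"
  shows "killing \<sigma> (\<lambda>x. f x * g x) x = f x * killing \<sigma> g x + killing \<sigma> f x * g x"
  using assms by (simp add: killing_def partial_mult algebra_simps)

text \<open>The infinitesimal form of helical symmetry of a field given by its components.\<close>

definition helical :: "real \<Rightarrow> (3 \<Rightarrow> real^3 \<Rightarrow> real) \<Rightarrow> bool" where
  "helical \<sigma> v \<longleftrightarrow> (\<forall>x. killing \<sigma> (v 1) x = v 2 x \<and> killing \<sigma> (v 2) x = - v 1 x \<and> killing \<sigma> (v 3) x = 0)"

lemma polar_deriv_angular_killing:
  assumes "f differentiable (at (polar r t))"
  shows "((\<lambda>t. f (polar r t)) has_real_derivative
    \<sigma> * partial 3 f (polar r t) - killing \<sigma> f (polar r t)) (at t)"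
  using polar_deriv_angular[OF assms] by (simp add: killing_def algebra_simps)

text \<open>The flux does not depend on the radius, and it is 0 at radius 0.\<close>

lemma circ_rad_eq_0:
  assumes "\<sigma> \<noteq> 0" and "\<And>j. Ck (Suc k) (F j)" and "\<And>x. killing \<sigma> (F 3) x = 0"
    and "\<And>x. divg F x = 0"
  shows "circ (rad F) r = 0"
proof -
  have "(circ (rad F) has_real_derivative 0) (at r)" for r
    using flux_deriv[where F = F and \<sigma> = \<sigma> and k = k and r = r] assms by simp
  then have "circ (rad F) r = circ (rad F) 0"
    using DERIV_isconst_all by blast
  then show ?thesis
    by (simp add: circ_def rad_def[abs_def])
qed

section \<open>Functions of mean zero and the radial component\<close>

lemma diff_le_integral_abs_deriv:
  fixes f f' :: "real \<Rightarrow> real"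
  assumes "\<And>t. (f has_real_derivative f' t) (at t)" and cont: "continuous_on UNIV f'"
    and "x \<in> {a..b}" "y \<in> {a..b}"
  shows "f x \<le> f y + integral {a..b} (\<lambda>t. \<bar>f' t\<bar>)"
proof -
  have *: "\<bar>f v - f u\<bar> \<le> integral {a..b} (\<lambda>t. \<bar>f' t\<bar>)" if "u \<le> v" "a \<le> u" "v \<le> b" for u v
  proof -
    have c: "continuous_on A f'" "continuous_on A (\<lambda>t. \<bar>f' t\<bar>)" for A
      using continuous_on_subset[OF cont] by (auto intro!: continuous_intros)
    have "(f' has_integral (f v - f u)) {u..v}"
      using that assms(1) by (intro fundamental_theorem_of_calculus)
        (auto intro: has_field_derivative_at_within simp flip: has_real_derivative_iff_has_vector_derivative)
    then have "\<bar>f v - f u\<bar> = \<bar>integral {u..v} f'\<bar>"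
      by (simp add: integral_unique)
    also have "\<dots> \<le> integral {u..v} (\<lambda>t. \<bar>f' t\<bar>)"
      by (intro integral_abs_le integrable_continuous_real c) auto
    also have "\<dots> \<le> integral {a..b} (\<lambda>t. \<bar>f' t\<bar>)"
      using that by (intro integral_subset_le integrable_continuous_real c) auto
    finally show ?thesis .
  qed
  show ?thesis
    using *[of x y] *[of y x] assms(3,4) by (cases "x \<le> y") auto
qed

text \<open>A Poincare inequality in the sup norm: averaging the oscillation bound over
  \<open>y\<close> replaces \<open>f y\<close> by the mean, which is 0.\<close>

lemma abs_le_of_mean_zero:
  fixes f f' :: "real \<Rightarrow> real"
  assumes f: "\<And>t. (f has_real_derivative f' t) (at t)" and cont: "continuous_on UNIV f'"
    and mean: "integral {a..b} f = 0" and x: "x \<in> {a..b}" and ab: "a < b"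
  shows "\<bar>f x\<bar> \<le> integral {a..b} (\<lambda>t. \<bar>f' t\<bar>)"
proof -
  define V where "V = integral {a..b} (\<lambda>t. \<bar>f' t\<bar>)"
  have cf: "continuous_on {a..b} f"
    using f by (intro DERIV_continuous_on[of _ _ f']) (auto intro: has_field_derivative_at_within)
  have osc: "f x \<le> f y + V" "f y \<le> f x + V" if "y \<in> {a..b}" for y
    unfolding V_def using diff_le_integral_abs_deriv[OF f cont] x that by auto
  have "integral {a..b} (\<lambda>y. f x) \<le> integral {a..b} (\<lambda>y. f y + V)"
    by (intro integral_le integrable_continuous_real continuous_intros cf osc)
  moreover have "integral {a..b} (\<lambda>y. f y) \<le> integral {a..b} (\<lambda>y. f x + V)"
    by (intro integral_le integrable_continuous_real continuous_intros cf osc)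
  moreover have "integral {a..b} (\<lambda>y. f y + V) = integral {a..b} f + integral {a..b} (\<lambda>y. V)"
    by (intro integral_add integrable_continuous_real continuous_intros cf)
  ultimately have "(b - a) * f x \<le> (b - a) * V" "0 \<le> (b - a) * (f x + V)"
    using ab mean by (simp_all)
  then have "f x \<le> V" "0 \<le> f x + V"
    using ab by (simp_all add: zero_le_mult_iff)
  then show ?thesis unfolding V_def by linarith
qed

text \<open>The radial component of an equivariant field is an invariant scalar: the derivatives of
  cos and sin cancel against the rotation terms in \<open>helical\<close>, and only the axial
  derivative is left.\<close>

lemma radial_component_deriv:
  assumes F: "\<And>j. Ck (Suc k) (F j)" and hel: "helical \<sigma> F"
  shows "((\<lambda>t. cos t * F 1 (polar r t) + sin t * F 2 (polar r t)) has_real_derivative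
    \<sigma> * (cos t * partial 3 (F 1) (polar r t) + sin t * partial 3 (F 2) (polar r t))) (at t)"
proof -
  note d = polar_deriv_angular_killing[OF Ck_differentiable[OF F], where \<sigma> = \<sigma>]
  have K: "killing \<sigma> (F 1) x = F 2 x" "killing \<sigma> (F 2) x = - F 1 x" for x
    using hel by (auto simp: helical_def)
  show ?thesis
    by (rule derivative_eq_intros d | simp)+ (simp add: K algebra_simps)
qed

text \<open>Zero flux means mean zero on the circle, so the preceding Poincare inequality applies to
  the radial component.\<close>

lemma radial_component_bound:
  assumes "\<sigma> \<noteq> 0" and F: "\<And>j. Ck (Suc k) (F j)" and hel: "helical \<sigma> F"
    and div: "\<And>x. divg F x = 0" and "r \<noteq> 0" and t: "t \<in> {0..2*pi}"
  shows "\<bar>cos t * F 1 (polar r t) + sin t * F 2 (polar r t)\<bar>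
    \<le> \<bar>\<sigma>\<bar> * circ (\<lambda>r t. \<bar>cos t * partial 3 (F 1) (polar r t) + sin t * partial 3 (F 2) (polar r t)\<bar>) r"
proof -
  let ?f = "\<lambda>t. cos t * F 1 (polar r t) + sin t * F 2 (polar r t)"
  let ?f' = "\<lambda>t. \<sigma> * (cos t * partial 3 (F 1) (polar r t) + sin t * partial 3 (F 2) (polar r t))"
  have K: "killing \<sigma> (F 3) x = 0" for x
    using hel by (auto simp: helical_def)
  have "(?f has_real_derivative ?f' t) (at t)" for t
    using radial_component_deriv[where F = F, OF F hel] .
  moreover have "continuous_on UNIV ?f'"
    by (intro continuous_intros continuous_on_comp_polar Ck_continuous_on[OF Ck_partial[OF F]])
  moreover have "circ (rad F) r = 0"
    by (rule circ_rad_eq_0[where k = k]) (rule assms(1) F K div)+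
  then have "integral {0..2*pi} ?f = 0"
    using \<open>r \<noteq> 0\<close> by (simp add: circ_def rad_def[abs_def])
  ultimately have "\<bar>?f t\<bar> \<le> integral {0..2*pi} (\<lambda>t. \<bar>?f' t\<bar>)"
    using t by (intro abs_le_of_mean_zero) auto
  then show ?thesis
    by (simp add: circ_def abs_mult)
qed

text \<open>The integral of \<open>f r\<close> from \<open>0\<close> to \<open>t\<close>, rescaled to the unit interval so that it is
  also the right antiderivative for negative \<open>t\<close>.\<close>

definition primitive :: "(real \<Rightarrow> real \<Rightarrow> real) \<Rightarrow> real \<Rightarrow> real \<Rightarrow> real" where
  "primitive f r t = t * integral {0..1} (\<lambda>s. f r (s * t))"

lemma integral_scaled_deriv:
  fixes f f' :: "real \<Rightarrow> real"
  assumes "\<And>t. (f has_real_derivative f' t) (at t)"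
  shows "t * integral {0..1} (\<lambda>s. f' (s * t)) = f t - f 0"
proof -
  have "((\<lambda>s. f (s * t)) has_real_derivative f' (s * t) * t) (at s)" for s
    by (rule DERIV_chain2[OF assms]) (auto intro!: derivative_eq_intros)
  then have "((\<lambda>s. f' (s * t) * t) has_integral (f (1 * t) - f (0 * t))) {0..1}"
    by (intro fundamental_theorem_of_calculus)
      (auto intro: has_field_derivative_at_within simp flip: has_real_derivative_iff_has_vector_derivative)
  from integral_unique[OF this] show ?thesis
    by (simp add: mult.commute)
qed

lemma continuous_primitive:
  assumes "continuous_on UNIV (\<lambda>p. f (fst p) (snd p))"
  shows "continuous_on UNIV (\<lambda>p. primitive f (fst p) (snd p))"
proof -
  have "continuous_on (UNIV \<times> cbox 0 1) (\<lambda>(p, s). f (fst p) (s * snd p))"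
    unfolding split_beta'
    by (rule continuous_on_compose2[OF assms, of _ "\<lambda>q. (fst (fst q), snd q * snd (fst q))", simplified])
      (auto intro!: continuous_intros)
  then have "continuous_on UNIV (\<lambda>p. integral (cbox 0 1) (\<lambda>s. f (fst p) (s * snd p)))"
    by (rule integral_continuous_on_param)
  then show ?thesis
    unfolding primitive_def by (auto intro!: continuous_intros)
qed

lemma primitive_deriv:
  assumes f: "\<And>t. (f r has_real_derivative f' t) (at t)"
    and cont: "continuous_on UNIV (f r)" "continuous_on UNIV f'"
  shows "(primitive f r has_real_derivative f r t) (at t)"
proof -
  have c: "continuous_on A (\<lambda>x. f r (a x))" "continuous_on A (\<lambda>x. f' (a x))"
    if "continuous_on A a" for A and a :: "'x::topological_space \<Rightarrow> real"
    using that continuous_on_compose2[OF cont(1)] continuous_on_compose2[OF cont(2)] by auto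
  have "((\<lambda>t. f r (s * t)) has_real_derivative s * f' (s * t)) (at t)" for s t
    by (rule DERIV_cong[OF DERIV_chain2[OF f]]) (auto intro!: derivative_eq_intros)
  then have "((\<lambda>t. integral {0..1} (\<lambda>s. f r (s * t))) has_real_derivative
      integral {0..1} (\<lambda>s. s * f' (s * t))) (at t)"
    by (rule integral_param_deriv) (intro continuous_intros c)+
  then have "(primitive f r has_real_derivative
      integral {0..1} (\<lambda>s. f r (s * t)) + t * integral {0..1} (\<lambda>s. s * f' (s * t))) (at t)"
    unfolding primitive_def[abs_def] by (auto intro!: derivative_eq_intros)
  moreover have "integral {0..1} (\<lambda>s. f r (s * t)) + t * integral {0..1} (\<lambda>s. s * f' (s * t)) = f r t"
  proof -
    \<comment> \<open>The two integrals combine into the integral of an exact s-derivative, that of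
      s f(r, s t).\<close>
    have "((\<lambda>s. s * f r (s * t)) has_real_derivative f r (s * t) + t * (s * f' (s * t))) (at s)" for s
      by (rule derivative_eq_intros DERIV_chain2[OF f] | simp)+
    then have "((\<lambda>s. f r (s * t) + t * (s * f' (s * t))) has_integral (1 * f r (1 * t) - 0 * f r (0 * t))) {0..1}"
      by (intro fundamental_theorem_of_calculus)
        (auto intro: has_field_derivative_at_within simp flip: has_real_derivative_iff_has_vector_derivative)
    then have "integral {0..1} (\<lambda>s. f r (s * t) + t * (s * f' (s * t))) = f r t"
      by (simp add: integral_unique)
    moreover have "integral {0..1} (\<lambda>s. f r (s * t) + t * (s * f' (s * t)))
        = integral {0..1} (\<lambda>s. f r (s * t)) + integral {0..1} (\<lambda>s. t * (s * f' (s * t)))"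
      by (intro integral_add integrable_continuous_real continuous_intros c)
    ultimately show ?thesis by simp
  qed
  ultimately show ?thesis by simp
qed

lemma primitive_abs_le:
  assumes cont: "continuous_on UNIV (f r)" and "\<And>t. \<bar>f r t\<bar> \<le> M" and t: "0 \<le> t"
  shows "\<bar>primitive f r t\<bar> \<le> t * M"
proof -
  have "continuous_on {0..1} (\<lambda>s. f r (s * t))"
    by (rule continuous_on_compose2[OF cont]) (auto intro!: continuous_intros)
  then have "\<bar>integral {0..1} (\<lambda>s. f r (s * t))\<bar> \<le> integral {0..1} (\<lambda>s::real. M)"
    using assms(2) by (intro integral_abs_le integrable_continuous_real) auto
  then show ?thesis
    using t by (simp add: primitive_def abs_mult mult_left_mono)
qed

section \<open>A vanishing criterion for the energy\<close>

lemma increasing_of_derivative_nonneg: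
  fixes E e :: "real \<Rightarrow> real"
  assumes "\<And>r. 0 \<le> r \<Longrightarrow> (E has_real_derivative e r) (at r)" "\<And>r. 0 \<le> r \<Longrightarrow> 0 \<le> e r"
    and "0 \<le> a" "a \<le> b"
  shows "E a \<le> E b"
proof (rule DERIV_nonneg_imp_nondecreasing[OF assms(4)])
  fix x assume "a \<le> x" "x \<le> b"
  then have "0 \<le> x" using assms(3) by simp
  then show "\<exists>y. (E has_real_derivative y) (at x) \<and> 0 \<le> y" using assms(1,2) by blast
qed

text \<open>The weight is \<open>\<eta> = (1 - w) w\<^sup>3\<close> with \<open>w = (2R - r)/R\<close>. Its primitive is comparable to \<open>w\<^sup>4\<close>,
  whereas \<open>\<eta>\<close> and \<open>\<eta>'\<close> are bounded by multiples of \<open>w\<^sup>2\<close>, so that the right-hand side is controlled by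
  the same weighted integral of \<open>e\<close> as the left-hand side.\<close>

lemma cutoff_energy_bound:
  fixes E e S g g' \<kappa> :: "real \<Rightarrow> real"
  assumes R: "R \<ge> 1" and C: "C \<ge> 0" and t: "t > 0"
    and E: "\<And>r. 0 \<le> r \<Longrightarrow> (E has_real_derivative e r) (at r)"
    and e: "\<And>r. 0 \<le> r \<Longrightarrow> 0 \<le> e r" and E0: "E 0 = 0"
    and ce: "continuous_on UNIV e" and cS: "continuous_on UNIV S"
    and g: "\<And>r. 1 \<le> r \<Longrightarrow> (g has_real_derivative g' r) (at r)"
    and rE: "\<And>r. 1 \<le> r \<Longrightarrow> r * E r = \<kappa> r + g' r"
    and ck: "continuous_on {1..} \<kappa>"
    and bk: "\<And>r. 1 \<le> r \<Longrightarrow> \<bar>\<kappa> r\<bar> \<le> C * r\<^sup>2 * S r"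
    and bg: "\<And>r. 1 \<le> r \<Longrightarrow> \<bar>g r\<bar> \<le> C * r\<^sup>2 * S r"
    and S: "\<And>r t. 1 \<le> r \<Longrightarrow> 0 < t \<Longrightarrow> S r \<le> t * e r + 2 / (t * r)"
  defines "I \<equiv> integral {R..2*R} (\<lambda>r. ((2*R - r) / R) ^ 4 * e r)"
  shows "E R + I \<le> 320 * C * (t * I + 2 / t)" and "0 \<le> I" and "I \<le> E (2*R) - E R"
proof -
  define w where "w r = (2*R - r) / R" for r
  let ?eta = "\<lambda>r. (1 - w r) * w r ^ 3"
  let ?eta' = "\<lambda>r. (4 * w r ^ 3 - 3 * w r ^ 2) / R"
  \<comment> \<open>An antiderivative of -\<open>?eta\<close> in \<open>r\<close>, because
    \<open>w\<close> has slope -1/R. It is 0 at 2R and R (1/4 - 1/5) = R/20 at R; this R/20 is the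
    weight of \<open>E R\<close> below.\<close>
  let ?Phi = "\<lambda>r. R * (w r ^ 4 / 4 - w r ^ 5 / 5)"
  have R0: "R > 0" "R \<le> 2*R" using R by auto
  have w01: "0 \<le> w r" "w r \<le> 1" if "r \<in> {R..2*R}" for r
    using that R0 by (auto simp: w_def field_simps)
  have Epos: "0 \<le> E r" if "0 \<le> r" for r
    using increasing_of_derivative_nonneg[of E e 0 r] E e E0 that by simp
  have cE: "continuous_on {R..2*R} E"
    using E R by (intro DERIV_continuous_on[of _ _ e]) (auto intro: has_field_derivative_at_within)
  have cg: "continuous_on {R..2*R} g"
    using g R by (intro DERIV_continuous_on[of _ _ g']) (auto intro: has_field_derivative_at_within)
  have ck': "continuous_on {R..2*R} \<kappa>"
    using ck R by (auto elim: continuous_on_subset)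
  have cg': "continuous_on {R..2*R} g'"
  proof -
    \<comment> \<open>The identity \<open>rE\<close> presents \<open>g'\<close> as a continuous
      function.\<close>
    have "continuous_on {R..2*R} (\<lambda>r. r * E r - \<kappa> r)"
      by (intro continuous_intros cE ck')
    then show ?thesis
      by (rule continuous_on_eq) (use rE R in auto)
  qed
  note ce' = continuous_on_subset[OF ce subset_UNIV, of "{R..2*R}"]
  note cS' = continuous_on_subset[OF cS subset_UNIV, of "{R..2*R}"]
  have cw: "continuous_on {R..2*R} w"
    unfolding w_def using R0 by (intro continuous_intros) auto
  have wR [simp]: "w R = 1" "w (2*R) = 0"
    using R0 by (auto simp: w_def)
  have I: "I = integral {R..2*R} (\<lambda>r. w r ^ 4 * e r)"
    by (simp add: I_def w_def)
  note cts = cw cE cg ck' cg' ce' cS'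
  have wd: "(w has_real_derivative (-1/R)) (at r)" for r
    unfolding w_def[abs_def] using R0 by (auto intro!: derivative_eq_intros simp: field_simps)
  have etad: "(?eta has_real_derivative ?eta' r) (at r)" for r
    by (rule derivative_eq_intros wd | simp)+ (use R0 in \<open>simp add: field_simps power2_eq_square power3_eq_cube\<close>)
  have Phid: "(?Phi has_real_derivative - ?eta r) (at r)" for r
    by (rule derivative_eq_intros wd | simp)+ (use R0 in \<open>simp add: field_simps eval_nat_numeral\<close>)

  have ftc1: "((\<lambda>r. ?Phi r * e r - ?eta r * E r) has_integral (?Phi (2*R) * E (2*R) - ?Phi R * E R)) {R..2*R}"
  proof (rule fundamental_theorem_of_calculus)
    fix r assume "r \<in> {R..2*R}"
    then have "0 \<le> r" using R0 by simp
    from DERIV_mult'[OF Phid E[OF this]]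
    have "((\<lambda>r. ?Phi r * E r) has_real_derivative ?Phi r * e r - ?eta r * E r) (at r)"
      by (simp only: mult_minus_left diff_conv_add_uminus)
    then show "((\<lambda>r. ?Phi r * E r) has_vector_derivative ?Phi r * e r - ?eta r * E r) (at r within {R..2*R})"
      by (simp add: has_field_derivative_at_within flip: has_real_derivative_iff_has_vector_derivative)
  qed (use R0 in simp)
  \<comment> \<open>The factor 1 - w kills the boundary term at R and w^3 the one at 2R, so
    \<open>g\<close> enters only under an integral.\<close>
  have ftc2: "((\<lambda>r. ?eta r * g' r + ?eta' r * g r) has_integral (?eta (2*R) * g (2*R) - ?eta R * g R)) {R..2*R}"
  proof (rule fundamental_theorem_of_calculus)
    fix r assume "r \<in> {R..2*R}"
    then have "1 \<le> r" using R by simp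
    from DERIV_mult'[OF etad g[OF this]]
    show "((\<lambda>r. ?eta r * g r) has_vector_derivative ?eta r * g' r + ?eta' r * g r) (at r within {R..2*R})"
      by (simp add: has_field_derivative_at_within flip: has_real_derivative_iff_has_vector_derivative)
  qed (use R0 in simp)
  have int1: "integral {R..2*R} (\<lambda>r. ?eta r * E r) = R / 20 * E R + integral {R..2*R} (\<lambda>r. ?Phi r * e r)"
  proof -
    have "integral {R..2*R} (\<lambda>r. ?Phi r * e r) - integral {R..2*R} (\<lambda>r. ?eta r * E r)
        = integral {R..2*R} (\<lambda>r. ?Phi r * e r - ?eta r * E r)"
      by (intro integral_diff[symmetric] integrable_continuous_real continuous_intros cts) (use R0 in auto)
    also have "\<dots> = - (R / 20 * E R)"
      using ftc1 R0 by (simp add: integral_unique)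
    finally show ?thesis by simp
  qed
  have int2: "integral {R..2*R} (\<lambda>r. ?eta r * g' r) = - integral {R..2*R} (\<lambda>r. ?eta' r * g r)"
  proof -
    have "integral {R..2*R} (\<lambda>r. ?eta r * g' r) + integral {R..2*R} (\<lambda>r. ?eta' r * g r)
        = integral {R..2*R} (\<lambda>r. ?eta r * g' r + ?eta' r * g r)"
      by (intro integral_add[symmetric] integrable_continuous_real continuous_intros cts) (use R0 in auto)
    also have "\<dots> = 0"
      using ftc2 R0 by (simp add: integral_unique)
    finally show ?thesis by simp
  qed
  have Ipos: "0 \<le> I"
    unfolding I using R0 e w01 by (intro integral_nonneg integrable_continuous_real continuous_intros cts) auto
  show "0 \<le> I" by (rule Ipos)
  have "(e has_integral (E (2*R) - E R)) {R..2*R}"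
    using R0 by (intro fundamental_theorem_of_calculus)
      (auto intro!: has_field_derivative_at_within[OF E] simp: has_real_derivative_iff_has_vector_derivative[symmetric])
  then have "integral {R..2*R} e = E (2*R) - E R"
    by (rule integral_unique)
  moreover have "I \<le> integral {R..2*R} e"
    unfolding I
  proof (intro integral_le integrable_continuous_real continuous_intros cts)
    fix r assume r: "r \<in> {R..2*R}"
    then have "w r ^ 4 \<le> 1" using w01 by (intro power_le_one) auto
    then show "w r ^ 4 * e r \<le> e r"
      using e[of r] r R0 by (intro mult_left_le_one_le) auto
  qed
  ultimately show "I \<le> E (2*R) - E R" by simp

  have lower: "R / 20 * (E R + I) \<le> integral {R..2*R} (\<lambda>r. ?eta r * E r)"
  proof -
    have "R / 20 * I = integral {R..2*R} (\<lambda>r. R / 20 * (w r ^ 4 * e r))"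
      by (simp add: I)
    also have "\<dots> \<le> integral {R..2*R} (\<lambda>r. ?Phi r * e r)"
    proof (intro integral_le integrable_continuous_real continuous_intros cts)
      fix r assume r: "r \<in> {R..2*R}"
      have "w r ^ 5 \<le> w r ^ 4"
        using w01[OF r] by (intro power_decreasing) auto
      then have "R / 20 * w r ^ 4 \<le> ?Phi r"
        using R0 by (simp add: field_simps)
      then show "R / 20 * (w r ^ 4 * e r) \<le> ?Phi r * e r"
        using mult_right_mono[of "R / 20 * w r ^ 4" "?Phi r" "e r"] e[of r] r R0 by (simp add: mult.assoc)
    qed (use R0 in auto)
    finally show ?thesis
      by (simp add: int1 distrib_left)
  qed
  \<comment> \<open>Since R \<le> r on the annulus, the extra factor R allows E to be replaced by r
    E, the quantity that \<open>rE\<close> describes.\<close>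
  have "R * integral {R..2*R} (\<lambda>r. ?eta r * E r) = integral {R..2*R} (\<lambda>r. R * (?eta r * E r))"
    by simp
  also have "\<dots> \<le> integral {R..2*R} (\<lambda>r. ?eta r * (r * E r))"
  proof (intro integral_le integrable_continuous_real continuous_intros cts)
    fix r assume r: "r \<in> {R..2*R}"
    have "0 \<le> ?eta r * E r"
      using w01[OF r] Epos r R0 by (intro mult_nonneg_nonneg) auto
    then have "R * (?eta r * E r) \<le> r * (?eta r * E r)"
      using r by (intro mult_right_mono) auto
    then show "R * (?eta r * E r) \<le> ?eta r * (r * E r)"
      by (simp add: mult_ac)
  qed
  also have "\<dots> = integral {R..2*R} (\<lambda>r. ?eta r * \<kappa> r + ?eta r * g' r)"
    by (rule integral_cong) (use rE R in \<open>auto simp: distrib_left\<close>)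
  also have "\<dots> = integral {R..2*R} (\<lambda>r. ?eta r * \<kappa> r) + integral {R..2*R} (\<lambda>r. ?eta r * g' r)"
    by (intro integral_add integrable_continuous_real continuous_intros cts)
  also have "\<dots> = integral {R..2*R} (\<lambda>r. ?eta r * \<kappa> r) - integral {R..2*R} (\<lambda>r. ?eta' r * g r)"
    by (simp only: int2)
  also have "\<dots> = integral {R..2*R} (\<lambda>r. ?eta r * \<kappa> r - ?eta' r * g r)"
    by (intro integral_diff[symmetric] integrable_continuous_real continuous_intros cts) (use R0 in auto)
  \<comment> \<open>Here 16 = (1 + 3) * 2^2: the weights satisfy |eta| \<le> w^2 and |eta'| \<le> 3
    w^2, and r \<le> 2R. With the 20 from \<open>?Phi\<close> this becomes the final 320.\<close>
  also have "\<dots> \<le> integral {R..2*R} (\<lambda>r. 16 * C * R\<^sup>2 * (t * (w r ^ 4 * e r) + 2 / (t * R)))"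
  proof (intro integral_le integrable_continuous_real continuous_intros cts)
    fix r assume r: "r \<in> {R..2*R}"
    define v where "v = w r"
    have r1: "1 \<le> r" using r R by simp
    have v: "0 \<le> v" "v \<le> 1" using w01[OF r] by (auto simp: v_def)
    have Srn: "0 \<le> C * r\<^sup>2 * S r" using bk[OF r1] by linarith
    have eta: "\<bar>(1 - v) * v ^ 3\<bar> \<le> v\<^sup>2"
    proof -
      have eq: "(1 - v) * v ^ 3 = ((1 - v) * v) * v\<^sup>2"
        by (simp add: power2_eq_square power3_eq_cube)
      have "(1 - v) * v \<le> 1" "0 \<le> (1 - v) * v"
        using v by (simp_all add: mult_le_one)
      then show ?thesis
        unfolding eq using mult_right_mono[of "(1 - v) * v" 1 "v\<^sup>2"]
        by (subst abs_of_nonneg) auto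
    qed
    have eta': "\<bar>(4 * v ^ 3 - 3 * v\<^sup>2) / R\<bar> \<le> 3 * v\<^sup>2"
    proof -
      have "4 * v ^ 3 - 3 * v\<^sup>2 = (4 * v - 3) * v\<^sup>2" by (simp add: power2_eq_square power3_eq_cube algebra_simps)
      moreover have "\<bar>4 * v - 3\<bar> \<le> 3" using v by auto
      ultimately have "\<bar>4 * v ^ 3 - 3 * v\<^sup>2\<bar> \<le> 3 * v\<^sup>2"
        by (simp add: abs_mult mult_right_mono)
      moreover have "\<bar>x\<bar> / R \<le> \<bar>x\<bar>" for x :: real
        using R by (simp add: divide_le_eq mult_left_le mult_le_cancel_left1)
      ultimately show ?thesis
        using R0 unfolding abs_divide by (metis abs_of_pos order_trans)
    qed
    have "(1 - v) * v ^ 3 * \<kappa> r - (4 * v ^ 3 - 3 * v\<^sup>2) / R * g r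
        \<le> \<bar>(1 - v) * v ^ 3\<bar> * \<bar>\<kappa> r\<bar> + \<bar>(4 * v ^ 3 - 3 * v\<^sup>2) / R\<bar> * \<bar>g r\<bar>"
      unfolding abs_mult[symmetric] by linarith
    also have "\<dots> \<le> v\<^sup>2 * (C * r\<^sup>2 * S r) + 3 * v\<^sup>2 * (C * r\<^sup>2 * S r)"
      by (intro add_mono mult_mono eta eta' bk bg r1) auto
    also have "\<dots> = 4 * C * r\<^sup>2 * (v\<^sup>2 * S r)" by (simp add: algebra_simps)
    also have "\<dots> \<le> 4 * C * r\<^sup>2 * (t * (v ^ 4 * e r) + 2 / (t * R))"
    proof (intro mult_left_mono)
      show "v\<^sup>2 * S r \<le> t * (v ^ 4 * e r) + 2 / (t * R)"
      proof (cases "v = 0")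
        case True
        then show ?thesis using t R0 by simp
      next
        case False
        then have w2: "0 < v\<^sup>2" by simp
        \<comment> \<open>The parameter in the bound for \<open>S\<close> is rescaled by v^2:
          multiplied by v^2, the bound has weight v^4 on \<open>e\<close>, as in \<open>I\<close>,
          and no weight on the remainder. This requires v > 0; the case v = 0 is trivial.\<close>
        then have "S r \<le> (t * v\<^sup>2) * e r + 2 / ((t * v\<^sup>2) * r)"
          using t by (intro S[OF r1]) auto
        then have "v\<^sup>2 * S r \<le> v\<^sup>2 * ((t * v\<^sup>2) * e r + 2 / ((t * v\<^sup>2) * r))"
          using w2 by (intro mult_left_mono) auto
        also have "\<dots> = t * (v ^ 4 * e r) + 2 / (t * r)"
          using False t r1 by (simp add: field_simps power2_eq_square power4_eq_xxxx)
        also have "2 / (t * r) \<le> 2 / (t * R)"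
          using r R0 t by (intro divide_left_mono mult_left_mono mult_pos_pos) auto
        finally show ?thesis by simp
      qed
    qed (use C in auto)
    also have "\<dots> \<le> 4 * C * (2 * R)\<^sup>2 * (t * (v ^ 4 * e r) + 2 / (t * R))"
      using r C R0 t e[of r] v by (intro mult_right_mono mult_left_mono power_mono) auto
    finally show "?eta r * \<kappa> r - ?eta' r * g r \<le> 16 * C * R\<^sup>2 * (t * (w r ^ 4 * e r) + 2 / (t * R))"
      unfolding v_def by (simp add: power_mult_distrib)
  qed (use R0 in auto)
  also have "\<dots> = 16 * C * R\<^sup>2 * (t * I + 2 / t)"
  proof -
    have "integral {R..2*R} (\<lambda>r. t * (w r ^ 4 * e r) + 2 / (t * R))
        = integral {R..2*R} (\<lambda>r. t * (w r ^ 4 * e r)) + integral {R..2*R} (\<lambda>r. 2 / (t * R))"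
      by (intro integral_add integrable_continuous_real continuous_intros cts)
    also have "\<dots> = t * I + 2 / t"
      using R0 by (simp add: I)
    finally show ?thesis by simp
  qed
  finally have "R * integral {R..2*R} (\<lambda>r. ?eta r * E r) \<le> 16 * C * R\<^sup>2 * (t * I + 2 / t)" .
  moreover have "R * (R / 20 * (E R + I)) \<le> R * integral {R..2*R} (\<lambda>r. ?eta r * E r)"
    using lower R0 by (intro mult_left_mono) auto
  ultimately have "R * (R / 20 * (E R + I)) \<le> 16 * C * R\<^sup>2 * (t * I + 2 / t)"
    by (rule order_trans[rotated])
  then have "R\<^sup>2 * ((E R + I) / 20) \<le> R\<^sup>2 * (16 * C * (t * I + 2 / t))"
    by (simp add: power2_eq_square mult_ac)
  then have "(E R + I) / 20 \<le> 16 * C * (t * I + 2 / t)"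
    using R0 by (simp only: mult_le_cancel_left_pos zero_less_power)
  then show "E R + I \<le> 320 * C * (t * I + 2 / t)"
    by simp
qed

text \<open>The choice of \<open>t\<close> in the cutoff inequality first bounds the energy on all discs, so that
  its increment over dyadic annuli tends to zero; a second choice of \<open>t\<close> then forces it to vanish.\<close>

lemma energy_eq_0:
  fixes E e S g g' \<kappa> :: "real \<Rightarrow> real"
  assumes C: "C \<ge> 0"
    and E: "\<And>r. 0 \<le> r \<Longrightarrow> (E has_real_derivative e r) (at r)"
    and e: "\<And>r. 0 \<le> r \<Longrightarrow> 0 \<le> e r" and E0: "E 0 = 0"
    and ce: "continuous_on UNIV e" and cS: "continuous_on UNIV S"
    and g: "\<And>r. 1 \<le> r \<Longrightarrow> (g has_real_derivative g' r) (at r)"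
    and rE: "\<And>r. 1 \<le> r \<Longrightarrow> r * E r = \<kappa> r + g' r"
    and ck: "continuous_on {1..} \<kappa>"
    and bk: "\<And>r. 1 \<le> r \<Longrightarrow> \<bar>\<kappa> r\<bar> \<le> C * r\<^sup>2 * S r"
    and bg: "\<And>r. 1 \<le> r \<Longrightarrow> \<bar>g r\<bar> \<le> C * r\<^sup>2 * S r"
    and S: "\<And>r t. 1 \<le> r \<Longrightarrow> 0 < t \<Longrightarrow> S r \<le> t * e r + 2 / (t * r)"
    and r: "0 \<le> r"
  shows "E r = 0"
proof -
  define I where "I R = integral {R..2*R} (\<lambda>r. ((2*R - r) / R) ^ 4 * e r)" for R
  \<comment> \<open>The added 1 keeps K positive, since both choices of t below involve division by
    K or by a multiple of it.\<close>
  define K where "K = 320 * C + 1"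
  have K: "K > 0" using C by (simp add: K_def)
  have cut: "E R + I R \<le> 320 * C * (t * I R + 2 / t)" "0 \<le> I R" "I R \<le> E (2*R) - E R"
    if "1 \<le> R" "0 < t" for R t
    using cutoff_energy_bound[where E = E and e = e and S = S and g = g and g' = g' and \<kappa> = \<kappa>
        and C = C and R = R and t = t, folded I_def]
      that C E e E0 ce cS g rE ck bk bg S by blast+
  have I0: "0 \<le> I R" and I1: "I R \<le> E (2*R) - E R" if "1 \<le> R" for R
    using cut(2,3)[OF that zero_less_one] by auto
  have IK: "E R + I R \<le> K * (t * I R + 2 / t)" if "1 \<le> R" "0 < t" for R t
  proof -
    have "E R + I R \<le> 320 * C * (t * I R + 2 / t)"
      by (rule cut(1)[OF that])
    also have "\<dots> \<le> K * (t * I R + 2 / t)"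
      using I0[OF that(1)] that(2) by (intro mult_right_mono) (auto simp: K_def)
    finally show ?thesis .
  qed
  have mono: "E a \<le> E b" if "0 \<le> a" "a \<le> b" for a b
    using increasing_of_derivative_nonneg[of E e a b] E e that by simp
  \<comment> \<open>With t = 1/K the term K t I is exactly I and cancels.\<close>
  have bounded: "E R \<le> 2 * K\<^sup>2" if "1 \<le> R" for R
    using IK[OF that, of "1/K"] K by (simp add: power2_eq_square distrib_left)
  define X where "X n = E (2 ^ n)" for n :: nat
  have "incseq X"
    unfolding X_def by (intro incseq_SucI mono) auto
  moreover have "X n \<le> 2 * K\<^sup>2" for n
    unfolding X_def by (intro bounded) simp
  ultimately obtain L where L: "X \<longlonglongrightarrow> L"
    using incseq_convergent[of X] by blast
  have "(\<lambda>n. X (Suc n) - X n) \<longlonglongrightarrow> L - L"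
    by (intro tendsto_diff L LIMSEQ_Suc)
  then have incr: "(\<lambda>n. X (Suc n) - X n) \<longlonglongrightarrow> 0" by simp
  have small: "X n \<le> \<epsilon>" if "0 < \<epsilon>" "X (Suc n) - X n < (\<epsilon> / K)\<^sup>2 / 8" for \<epsilon> n
  proof -
    have "I (2 ^ n) \<le> X (Suc n) - X n"
      using I1[of "2 ^ n"] by (simp add: X_def)
    then have I: "I (2 ^ n) \<le> (\<epsilon> / K)\<^sup>2 / 8" using that by simp
    \<comment> \<open>Chosen so that 2K/t = \<epsilon>/2; the threshold on the increment makes K t I
      at most \<epsilon>/2 as well.\<close>
    define t where "t = 4 * K / \<epsilon>"
    have t: "0 < t" using K that by (simp add: t_def)
    have "X n \<le> K * (t * I (2 ^ n) + 2 / t)"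
      using IK[of "2 ^ n" t] I0[of "2 ^ n"] t by (simp add: X_def)
    also have "\<dots> \<le> K * (t * ((\<epsilon> / K)\<^sup>2 / 8) + 2 / t)"
      using I t K by (intro mult_left_mono add_right_mono) auto
    also have "\<dots> = \<epsilon>"
      using that(1) K by (simp add: t_def field_simps power2_eq_square)
    finally show ?thesis .
  qed
  have "E r \<le> \<epsilon>" if "0 < \<epsilon>" for \<epsilon>
  proof -
    have "eventually (\<lambda>n. X (Suc n) - X n < (\<epsilon> / K)\<^sup>2 / 8) sequentially"
      by (rule order_tendstoD(2)[OF incr]) (use that K in simp)
    moreover have "eventually (\<lambda>n. r \<le> 2 ^ n) sequentially"
    proof -
      obtain N where "r < 2 ^ N" using real_arch_pow[of 2 r] by auto
      then have "r \<le> 2 ^ n" if "N \<le> n" for n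
        using power_increasing[OF that, of "2::real"] by linarith
      then show ?thesis
        unfolding eventually_sequentially by blast
    qed
    ultimately have "eventually (\<lambda>n. X (Suc n) - X n < (\<epsilon> / K)\<^sup>2 / 8 \<and> r \<le> 2 ^ n) sequentially"
      by (rule eventually_conj)
    then obtain n where n: "X (Suc n) - X n < (\<epsilon> / K)\<^sup>2 / 8" "r \<le> 2 ^ n"
      by (auto simp: eventually_sequentially)
    have "E r \<le> X n" unfolding X_def by (rule mono[OF r n(2)])
    also have "\<dots> \<le> \<epsilon>" by (rule small[OF that n(1)])
    finally show ?thesis .
  qed
  then have "E r \<le> 0"
    using dense_ge by blast
  moreover have "0 \<le> E r"
    using mono[of 0 r] r E0 by simp
  ultimately show ?thesis by simp
qed

section \<open>The steady MHD system in components\<close>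

lemma abs_cos_sin_le:
  assumes "\<bar>x\<bar> \<le> (M::real)" "\<bar>y\<bar> \<le> M"
  shows "\<bar>cos t * x + sin t * y\<bar> \<le> 2 * M" "\<bar>cos t * x - sin t * y\<bar> \<le> 2 * M"
proof -
  have "\<bar>cos t * x\<bar> \<le> 1 * M" "\<bar>sin t * y\<bar> \<le> 1 * M"
    unfolding abs_mult using assms by (intro mult_mono abs_cos_le_one abs_sin_le_one; simp)+
  then show "\<bar>cos t * x + sin t * y\<bar> \<le> 2 * M" "\<bar>cos t * x - sin t * y\<bar> \<le> 2 * M"
    by linarith+
qed

lemma abs_mult_bound: "\<bar>x\<bar> \<le> X \<Longrightarrow> \<bar>y\<bar> \<le> Y \<Longrightarrow> \<bar>x * y\<bar> \<le> X * (Y::real)"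
  unfolding abs_mult by (intro mult_mono) auto

text \<open>The system by components, with symmetry in infinitesimal form only. Helicity of the
  axial derivatives is listed separately, since deducing it from \<open>hel_u\<close> and
  \<open>hel_h\<close> would mean interchanging partial derivatives; it is supplied by
  differentiating the group form. The rate \<open>c\<close> is shown to be 0 inside the
  locale.\<close>

locale helical_mhd =
  fixes \<sigma> b c :: real and u h :: "3 \<Rightarrow> real^3 \<Rightarrow> real" and P :: "real^3 \<Rightarrow> real"
  assumes sigma: "\<sigma> \<noteq> 0"
    and u_C2: "\<And>j. Ck (Suc (Suc 0)) (u j)" and h_C2: "\<And>j. Ck (Suc (Suc 0)) (h j)"
    and P_C1: "Ck (Suc 0) P"
    and momentum: "\<And>j x. (\<Sum>i\<in>UNIV. partial i (partial i (u j)) x)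
      = (\<Sum>i\<in>UNIV. u i x * partial i (u j) x) - (\<Sum>i\<in>UNIV. h i x * partial i (h j) x) + partial j P x"
    and induction: "\<And>j x. (\<Sum>i\<in>UNIV. partial i (partial i (h j)) x)
      = (\<Sum>i\<in>UNIV. u i x * partial i (h j) x) - (\<Sum>i\<in>UNIV. h i x * partial i (u j) x)"
    and div_u: "\<And>x. divg u x = 0" and div_h: "\<And>x. divg h x = 0"
    and hel_u: "helical \<sigma> u" and hel_h: "helical \<sigma> h"
    and hel_du: "helical \<sigma> (\<lambda>j. partial 3 (u j))" and hel_dh: "helical \<sigma> (\<lambda>j. partial 3 (h j))"
    and killing_P: "\<And>x. killing \<sigma> P x = c"
    and bound_u: "\<And>j x. \<bar>u j x\<bar> \<le> b" and bound_h: "\<And>j x. \<bar>h j x\<bar> \<le> b"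
begin

definition dissip :: "real^3 \<Rightarrow> real" where
  "dissip x = (\<Sum>i\<in>UNIV. \<Sum>j\<in>UNIV. (partial i (u j) x)\<^sup>2 + (partial i (h j) x)\<^sup>2)"

definition energy :: "real^3 \<Rightarrow> real" where
  "energy x = (u 1 x * u 1 x + u 2 x * u 2 x + u 3 x * u 3 x
    + h 1 x * h 1 x + h 2 x * h 2 x + h 3 x * h 3 x) * (1/2)"

definition cross :: "real^3 \<Rightarrow> real" where
  "cross x = u 1 x * h 1 x + u 2 x * h 2 x + u 3 x * h 3 x"

definition grad_energy :: "3 \<Rightarrow> real^3 \<Rightarrow> real" where
  "grad_energy i x = u 1 x * partial i (u 1) x + u 2 x * partial i (u 2) x + u 3 x * partial i (u 3) x
    + (h 1 x * partial i (h 1) x + h 2 x * partial i (h 2) x + h 3 x * partial i (h 3) x)"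

text \<open>The part of the energy flux that is controlled pointwise by the fields and their
  gradients; \<open>total_flux\<close> adds the uncontrolled pressure term.\<close>

definition kinetic_flux :: "3 \<Rightarrow> real^3 \<Rightarrow> real" where
  "kinetic_flux i x = grad_energy i x - u i x * energy x + h i x * cross x"

definition total_flux :: "3 \<Rightarrow> real^3 \<Rightarrow> real" where
  "total_flux i x = kinetic_flux i x - u i x * P x"

text \<open>Viscous, Reynolds and Maxwell stress of the third momentum equation, with signs such
  that the divergence is the axial pressure derivative.\<close>

definition axial_flux :: "3 \<Rightarrow> real^3 \<Rightarrow> real" where
  "axial_flux i x = partial i (u 3) x - u i x * u 3 x + h i x * h 3 x"

lemma C1: "Ck (Suc 0) (u j)" "Ck (Suc 0) (h j)" "Ck (Suc 0) (partial i (u j))" "Ck (Suc 0) (partial i (h j))"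
  using u_C2 h_C2 Ck_SucD Ck_partial by blast+

lemma C1_derived:
  "Ck (Suc 0) energy" "Ck (Suc 0) cross" "Ck (Suc 0) (grad_energy i)"
  "Ck (Suc 0) (kinetic_flux i)" "Ck (Suc 0) (total_flux i)" "Ck (Suc 0) (axial_flux i)"
proof -
  show e: "Ck (Suc 0) energy" "Ck (Suc 0) cross" "Ck (Suc 0) (grad_energy i)" "Ck (Suc 0) (axial_flux i)"
    unfolding energy_def[abs_def] cross_def[abs_def] grad_energy_def[abs_def] axial_flux_def[abs_def]
    by (intro Ck_add Ck_diff Ck_mult Ck_const C1)+
  show k: "Ck (Suc 0) (kinetic_flux i)"
    unfolding kinetic_flux_def[abs_def] by (intro Ck_add Ck_diff Ck_mult e C1)
  show "Ck (Suc 0) (total_flux i)"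
    unfolding total_flux_def[abs_def] by (intro Ck_diff Ck_mult k C1 P_C1)
qed

lemmas diffs [simp] = C1[THEN Ck_differentiable] P_C1[THEN Ck_differentiable]
  C1_derived[THEN Ck_differentiable]

lemmas partial_rules = partial_add partial_diff partial_mult differentiable_add differentiable_diff
  differentiable_mult

lemma hel: "killing \<sigma> (u 1) x = u 2 x" "killing \<sigma> (u 2) x = - u 1 x" "killing \<sigma> (u 3) x = 0"
  "killing \<sigma> (h 1) x = h 2 x" "killing \<sigma> (h 2) x = - h 1 x" "killing \<sigma> (h 3) x = 0"
  "killing \<sigma> (partial 3 (u 1)) x = partial 3 (u 2) x" "killing \<sigma> (partial 3 (u 2)) x = - partial 3 (u 1) x"
  "killing \<sigma> (partial 3 (u 3)) x = 0"
  "killing \<sigma> (partial 3 (h 1)) x = partial 3 (h 2) x" "killing \<sigma> (partial 3 (h 2)) x = - partial 3 (h 1) x"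
  "killing \<sigma> (partial 3 (h 3)) x = 0"
  using hel_u hel_h hel_du hel_dh by (auto simp: helical_def)

lemma partial_energy: "partial i energy x = grad_energy i x"
  unfolding energy_def[abs_def] grad_energy_def
  by (subst partial_mult) (simp_all add: partial_rules)

lemma partial_cross: "partial i cross x = u 1 x * partial i (h 1) x + u 2 x * partial i (h 2) x
    + u 3 x * partial i (h 3) x + partial i (u 1) x * h 1 x + partial i (u 2) x * h 2 x + partial i (u 3) x * h 3 x"
  unfolding cross_def[abs_def] by (simp add: partial_rules)

lemma partial_grad_energy: "partial i (grad_energy i) x =
    (\<Sum>j\<in>UNIV. (partial i (u j) x)\<^sup>2 + (partial i (h j) x)\<^sup>2
      + u j x * partial i (partial i (u j)) x + h j x * partial i (partial i (h j)) x)"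
  unfolding grad_energy_def[abs_def] sum_3
  by (simp add: partial_rules power2_eq_square)

lemma killing_axial_flux: "killing \<sigma> (axial_flux 3) x = 0"
  unfolding axial_flux_def[abs_def]
  by (simp add: killing_add killing_diff killing_mult partial_rules hel)

text \<open>Inner products of equivariant fields are invariant: the two rotation terms in
  \<open>helical\<close> have opposite signs and cancel.\<close>

lemma killing_kinetic_flux: "killing \<sigma> (kinetic_flux 3) x = 0"
proof -
  have "killing \<sigma> energy x = u 1 x * killing \<sigma> (u 1) x + u 2 x * killing \<sigma> (u 2) x
      + u 3 x * killing \<sigma> (u 3) x + h 1 x * killing \<sigma> (h 1) x + h 2 x * killing \<sigma> (h 2) x
      + h 3 x * killing \<sigma> (h 3) x"
    by (simp add: killing_def partial_energy grad_energy_def algebra_simps)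
  then have "killing \<sigma> energy x = 0"
    by (simp add: hel)
  moreover have "killing \<sigma> cross x = 0" "killing \<sigma> (grad_energy 3) x = 0"
    unfolding cross_def[abs_def] grad_energy_def[abs_def]
    by (simp_all add: killing_add killing_mult partial_rules hel)
  ultimately show ?thesis
    unfolding kinetic_flux_def[abs_def]
    by (simp add: killing_add killing_diff killing_mult partial_rules hel)
qed

text \<open>In general the generator maps \<open>total_flux 3\<close> to -c \<open>u 3\<close>, so
  the energy flux identity has to wait for \<open>pressure_drop_eq_0\<close>.\<close>

lemma killing_total_flux: "c = 0 \<Longrightarrow> killing \<sigma> (total_flux 3) x = 0"
  unfolding total_flux_def[abs_def]
  by (simp add: killing_diff killing_mult partial_rules hel killing_kinetic_flux killing_P)

lemma divg_axial_flux: "divg axial_flux x = partial 3 P x"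
proof -
  have "divg axial_flux x = (\<Sum>i\<in>UNIV. partial i (partial i (u 3)) x)
      - ((\<Sum>i\<in>UNIV. u i x * partial i (u 3) x) + divg u x * u 3 x)
      + ((\<Sum>i\<in>UNIV. h i x * partial i (h 3) x) + divg h x * h 3 x)"
    unfolding divg_def axial_flux_def[abs_def] sum_3
    by (simp add: partial_rules algebra_simps)
  then show ?thesis
    using momentum[of 3 x] by (simp add: div_u div_h)
qed

text \<open>The local energy identity. The magnetic stretching terms of the two equations do not
  cancel pointwise; their sum is h . grad (u . h), which the \<open>cross\<close> term of the flux
  accounts for.\<close>

lemma divg_total_flux: "divg total_flux x = dissip x"
proof -
  have "divg total_flux x = (\<Sum>i\<in>UNIV. partial i (grad_energy i) x)
      - ((\<Sum>i\<in>UNIV. u i x * partial i energy x) + divg u x * energy x)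
      + ((\<Sum>i\<in>UNIV. h i x * partial i cross x) + divg h x * cross x)
      - ((\<Sum>i\<in>UNIV. u i x * partial i P x) + divg u x * P x)"
    unfolding divg_def total_flux_def[abs_def] kinetic_flux_def[abs_def] sum_3
    by (simp add: partial_rules algebra_simps)
  moreover have "(\<Sum>i\<in>UNIV. partial i (grad_energy i) x) = dissip x
      + (\<Sum>j\<in>UNIV. u j x * (\<Sum>i\<in>UNIV. partial i (partial i (u j)) x))
      + (\<Sum>j\<in>UNIV. h j x * (\<Sum>i\<in>UNIV. partial i (partial i (h j)) x))"
    unfolding partial_grad_energy dissip_def sum_3 by (simp add: algebra_simps)
  ultimately show ?thesis
    unfolding momentum induction div_u div_h partial_energy partial_cross grad_energy_def sum_3
    by (simp add: algebra_simps)
qed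

section \<open>The gradient norm and its integral over circles\<close>

definition grad_norm :: "real^3 \<Rightarrow> real" where "grad_norm x = sqrt (dissip x)"

definition circ_grad :: "real \<Rightarrow> real" where "circ_grad = circ (\<lambda>r t. grad_norm (polar r t))"

lemma continuous_dissip: "continuous_on UNIV dissip"
  unfolding dissip_def[abs_def]
  by (intro continuous_intros Ck_continuous_on[OF C1(3)] Ck_continuous_on[OF C1(4)])

lemma continuous_grad_norm: "continuous_on UNIV grad_norm"
  unfolding grad_norm_def[abs_def] by (intro continuous_intros continuous_dissip)

lemma continuous_dissip_polar: "continuous_on UNIV (\<lambda>p. dissip (polar (fst p) (snd p)))"
  by (intro continuous_on_comp_polar continuous_dissip continuous_intros)

lemma continuous_grad_norm_polar: "continuous_on UNIV (\<lambda>p. grad_norm (polar (fst p) (snd p)))"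
  by (intro continuous_on_comp_polar continuous_grad_norm continuous_intros)

lemma dissip_nonneg: "0 \<le> dissip x"
  unfolding dissip_def by (intro sum_nonneg add_nonneg_nonneg) auto

lemma grad_norm_nonneg: "0 \<le> grad_norm x"
  by (simp add: grad_norm_def dissip_nonneg)

lemma b_nonneg: "0 \<le> b"
  using bound_u[of 1 0] by linarith

lemma partial_le_grad_norm: "\<bar>partial i (u j) x\<bar> \<le> grad_norm x" "\<bar>partial i (h j) x\<bar> \<le> grad_norm x"
proof -
  let ?s = "\<lambda>i j. (partial i (u j) x)\<^sup>2 + (partial i (h j) x)\<^sup>2"
  have "?s i j \<le> (\<Sum>j\<in>UNIV. ?s i j)"
    by (rule member_le_sum) auto
  also have "\<dots> \<le> dissip x"
    unfolding dissip_def by (rule member_le_sum[of i UNIV "\<lambda>i. \<Sum>j\<in>UNIV. ?s i j"]) (auto intro!: sum_nonneg)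
  finally have "?s i j \<le> dissip x" .
  then have "(partial i (u j) x)\<^sup>2 \<le> dissip x" "(partial i (h j) x)\<^sup>2 \<le> dissip x"
    using zero_le_power2[of "partial i (u j) x"] zero_le_power2[of "partial i (h j) x"] by linarith+
  then show "\<bar>partial i (u j) x\<bar> \<le> grad_norm x" "\<bar>partial i (h j) x\<bar> \<le> grad_norm x"
    unfolding grad_norm_def by (simp_all add: real_le_rsqrt)
qed

lemma circ_grad_nonneg: "0 \<le> circ_grad r"
  unfolding circ_grad_def circ_def by (intro integral_nonneg integrable_section continuous_grad_norm_polar grad_norm_nonneg)

text \<open>This is the source of decay: in the quadratic flux terms one factor is radial and is
  bounded by \<open>circ_grad\<close> instead of \<open>b\<close>.\<close>

lemma radial_le_circ_grad:
  assumes r: "r \<noteq> 0" and t: "t \<in> {0..2*pi}"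
  shows "\<bar>cos t * u 1 (polar r t) + sin t * u 2 (polar r t)\<bar> \<le> 2 * \<bar>\<sigma>\<bar> * circ_grad r" (is ?u)
    and "\<bar>cos t * h 1 (polar r t) + sin t * h 2 (polar r t)\<bar> \<le> 2 * \<bar>\<sigma>\<bar> * circ_grad r" (is ?h)
proof -
  have *: "\<bar>cos t * F 1 (polar r t) + sin t * F 2 (polar r t)\<bar> \<le> 2 * \<bar>\<sigma>\<bar> * circ_grad r"
    if F: "\<And>j. Ck (Suc 0) (F j)" "helical \<sigma> F" "\<And>x. divg F x = 0"
      and le: "\<And>j x. \<bar>partial 3 (F j) x\<bar> \<le> grad_norm x" for F
  proof -
    let ?d = "\<lambda>r t. cos t * partial 3 (F 1) (polar r t) + sin t * partial 3 (F 2) (polar r t)"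
    have "\<bar>cos t * F 1 (polar r t) + sin t * F 2 (polar r t)\<bar> \<le> \<bar>\<sigma>\<bar> * circ (\<lambda>r t. \<bar>?d r t\<bar>) r"
      by (rule radial_component_bound[where k = 0]) (use sigma F r t in auto)
    also have "\<dots> \<le> \<bar>\<sigma>\<bar> * circ (\<lambda>r t. 2 * grad_norm (polar r t)) r"
      using abs_cos_sin_le(1)[OF le le]
      by (intro mult_left_mono circ_mono continuous_intros continuous_on_polar_pair[OF Ck_partial[OF F(1)]]
          continuous_grad_norm_polar abs_ge_zero)
    also have "circ (\<lambda>r t. 2 * grad_norm (polar r t)) r = 2 * circ_grad r"
      using circ_cmult[of "\<lambda>_. 2"] by (simp add: circ_grad_def)
    finally show ?thesis by simp
  qed
  show ?u by (rule *) (use C1 hel_u div_u partial_le_grad_norm in auto)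
  show ?h by (rule *) (use C1 hel_h div_h partial_le_grad_norm in auto)
qed

text \<open>Converts the pointwise flux bounds into circular ones; \<open>c1\<close> and
  \<open>c2\<close> may contain powers of \<open>r\<close>, as the radius is fixed.\<close>

lemma circ_abs_le_circ_grad:
  assumes "continuous_on UNIV (\<lambda>p. f (fst p) (snd p))"
    and "\<And>t. t \<in> {0..2*pi} \<Longrightarrow> \<bar>f r t\<bar> \<le> c1 * grad_norm (polar r t) + c2 * circ_grad r"
  shows "\<bar>circ f r\<bar> \<le> (c1 + 2 * pi * c2) * circ_grad r"
proof -
  have "\<bar>circ f r\<bar> \<le> circ (\<lambda>r' t. c1 * grad_norm (polar r' t) + c2 * circ_grad r) r"
    using assms by (intro circ_abs_le continuous_intros continuous_grad_norm_polar) auto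
  also have "\<dots> = c1 * circ_grad r + 2 * pi * (c2 * circ_grad r)"
    unfolding circ_grad_def
    by (subst circ_add, (intro continuous_intros continuous_grad_norm_polar)+, subst circ_cmult, simp)
  finally show ?thesis by (simp add: algebra_simps)
qed

text \<open>The angular derivative of P on the circle is \<sigma> times its axial derivative minus
  c, and its integral over the closed circle is 0.\<close>

lemma circ_axial_pressure: "\<sigma> * circ (\<lambda>r t. partial 3 P (polar r t)) r = 2 * pi * c"
proof -
  have "circ (\<lambda>r t. \<sigma> * partial 3 P (polar r t) - c) r = 0"
    using polar_deriv_angular_killing[where f = P and \<sigma> = \<sigma>]
    by (intro circ_integral_deriv_eq_0[of "\<lambda>r t. P (polar r t)"]) (auto simp: killing_P)
  moreover have "circ (\<lambda>r t. \<sigma> * partial 3 P (polar r t) - c) r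
      = \<sigma> * circ (\<lambda>r t. partial 3 P (polar r t)) r - 2 * pi * c"
    by (subst circ_diff, (intro continuous_intros continuous_on_polar_pair[OF Ck_partial[OF P_C1]])+,
        subst circ_cmult, simp)
  ultimately show ?thesis by simp
qed

lemma axial_flux_deriv:
  "(circ (rad axial_flux) has_real_derivative r * circ (\<lambda>r t. partial 3 P (polar r t)) r) (at r)"
  using flux_deriv[where F = axial_flux and k = 0 and \<sigma> = \<sigma> and r = r]
  by (simp only: sigma C1_derived killing_axial_flux divg_axial_flux simp_thms)

text \<open>A linear pressure drop along the helix would force the circular mean of the axial velocity
  to grow quadratically.\<close>

lemma pressure_drop_eq_0: "c = 0"
proof -
  \<comment> \<open>The axial flux has derivative 2 \<kappa> r by
    \<open>circ_axial_pressure\<close>, hence equals \<kappa> r^2. Division by r then gives q' =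
    \<kappa> r plus a bounded term, which is \<open>du\<close>.\<close>
  define \<kappa> where "\<kappa> = pi * c / \<sigma>"
  define q where "q = circ (\<lambda>r t. u 3 (polar r t))"
  let ?l = "\<lambda>r t. cos t * (u 1 (polar r t) * u 3 (polar r t) - h 1 (polar r t) * h 3 (polar r t))
      + sin t * (u 2 (polar r t) * u 3 (polar r t) - h 2 (polar r t) * h 3 (polar r t))"
  let ?du = "\<lambda>r t. cos t * partial 1 (u 3) (polar r t) + sin t * partial 2 (u 3) (polar r t)"
  note cont = continuous_on_polar_pair[OF C1(1)] continuous_on_polar_pair[OF C1(2)]
    continuous_on_polar_pair[OF C1(3)] continuous_rad[where F = axial_flux, OF C1_derived(6)]
  have "circ (rad axial_flux) r - \<kappa> * r\<^sup>2 = 0" for r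
  proof -
    have "((\<lambda>r. circ (rad axial_flux) r - \<kappa> * r\<^sup>2) has_real_derivative 0) (at r)" for r
    proof -
      have "((\<lambda>r. \<kappa> * r\<^sup>2) has_real_derivative \<kappa> * (2 * r)) (at r)"
        by (auto intro!: derivative_eq_intros)
      moreover have "r * circ (\<lambda>r t. partial 3 P (polar r t)) r - \<kappa> * (2 * r) = 0"
        using circ_axial_pressure[of r] sigma by (simp add: \<kappa>_def field_simps)
      ultimately show ?thesis
        using DERIV_diff[OF axial_flux_deriv[of r]] by metis
    qed
    then have "circ (rad axial_flux) r - \<kappa> * r\<^sup>2 = circ (rad axial_flux) 0 - \<kappa> * 0\<^sup>2"
      by (rule DERIV_isconst_all[rule_format, of "\<lambda>r. circ (rad axial_flux) r - \<kappa> * r\<^sup>2"])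
    then show ?thesis
      by (simp add: circ_def rad_def[abs_def])
  qed
  then have flux: "circ (rad axial_flux) r = \<kappa> * r\<^sup>2" for r by simp
  have dq: "(q has_real_derivative circ ?du r) (at r)" for r
    unfolding q_def by (rule circ_deriv) (intro polar_deriv_radial diffs continuous_intros cont)+
  have du: "circ ?du r = \<kappa> * r + circ ?l r" if "r \<noteq> 0" for r
  proof -
    have "\<kappa> * r\<^sup>2 = circ (\<lambda>r t. r * (?du r t - ?l r t)) r"
      unfolding flux[symmetric] circ_def
      by (rule integral_cong) (simp add: rad_def axial_flux_def algebra_simps)
    also have "\<dots> = r * (circ ?du r - circ ?l r)"
      by (subst circ_cmult, subst circ_diff) (intro continuous_intros cont refl)+
    finally have "r * (\<kappa> * r) = r * (circ ?du r - circ ?l r)"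
      by (simp add: power2_eq_square)
    then show ?thesis using that by simp
  qed
  have bl: "\<bar>circ ?l r\<bar> \<le> 2 * pi * (4 * b\<^sup>2)" for r
  proof -
    have "\<bar>u i x * u 3 x - h i x * h 3 x\<bar> \<le> 2 * b\<^sup>2" for i x
    proof -
      have "\<bar>u i x * u 3 x\<bar> \<le> b * b" "\<bar>h i x * h 3 x\<bar> \<le> b * b"
        unfolding abs_mult by (intro mult_mono bound_u bound_h b_nonneg abs_ge_zero)+
      then show ?thesis unfolding power2_eq_square by linarith
    qed
    then have "\<bar>circ ?l r\<bar> \<le> circ (\<lambda>r t. 2 * (2 * b\<^sup>2)) r"
      by (intro circ_abs_le abs_cos_sin_le continuous_intros cont)
    then show ?thesis by simp
  qed
  have bq: "\<bar>q r\<bar> \<le> 2 * pi * b" for r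
  proof -
    have "\<bar>q r\<bar> \<le> circ (\<lambda>r t. b) r"
      unfolding q_def by (intro circ_abs_le bound_u continuous_intros cont)
    then show ?thesis by simp
  qed
  define M where "M = 4 * pi * b + 2 * pi * (4 * b\<^sup>2)"
  have M: "0 \<le> M" using b_nonneg by (simp add: M_def)
  \<comment> \<open>Mean value theorem for q - \<kappa> r^2/2 on [1, 1 + n], with n real. The
    interval starts at 1 because \<open>du\<close> is available only for r different from 0, and n
    (n + 2) is (1 + n)^2 - 1.\<close>
  have "\<bar>\<kappa>\<bar> * (n + 2) \<le> 4 * M" if n: "1 \<le> n" for n
  proof -
    have D: "((\<lambda>r. q r - \<kappa> * r\<^sup>2 / 2) has_real_derivative circ ?du r - \<kappa> * r) (at r)" for r
    proof -
      have "((\<lambda>r. \<kappa> * r\<^sup>2 / 2) has_real_derivative \<kappa> * r) (at r)"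
        by (auto intro!: derivative_eq_intros)
      from DERIV_diff[OF dq this] show ?thesis .
    qed
    have "\<exists>z. 1 < z \<and> z < 1 + n \<and>
        (q (1 + n) - \<kappa> * (1 + n)\<^sup>2 / 2) - (q 1 - \<kappa> * 1\<^sup>2 / 2) = (1 + n - 1) * (circ ?du z - \<kappa> * z)"
      by (rule MVT2[of 1 "1 + n" "\<lambda>r. q r - \<kappa> * r\<^sup>2 / 2"]) (use n D in auto)
    then obtain z where z: "1 < z" and
        eq: "(q (1 + n) - \<kappa> * (1 + n)\<^sup>2 / 2) - (q 1 - \<kappa> * 1\<^sup>2 / 2) = n * (circ ?du z - \<kappa> * z)"
      by auto
    have "circ ?du z - \<kappa> * z = circ ?l z"
      using du[of z] z by simp
    note eq = eq[unfolded this]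
    have "\<kappa> * (n * (n + 2)) / 2 = q (1 + n) - q 1 - n * circ ?l z"
    proof -
      have "\<kappa> * (n * (n + 2)) / 2 = \<kappa> * (1 + n)\<^sup>2 / 2 - \<kappa> * 1\<^sup>2 / 2"
        by (simp add: power2_eq_square field_simps)
      then show ?thesis using eq by linarith
    qed
    moreover have "\<bar>n * circ ?l z\<bar> \<le> n * (2 * pi * (4 * b\<^sup>2))"
      unfolding abs_mult using n bl by (simp add: mult_left_mono)
    moreover have "\<bar>q (1 + n)\<bar> \<le> n * (2 * pi * b)" "\<bar>q 1\<bar> \<le> n * (2 * pi * b)"
    proof -
      have "1 * (2 * pi * b) \<le> n * (2 * pi * b)"
        using n b_nonneg by (intro mult_right_mono) auto
      then show "\<bar>q (1 + n)\<bar> \<le> n * (2 * pi * b)" "\<bar>q 1\<bar> \<le> n * (2 * pi * b)"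
        using bq[of "1 + n"] bq[of 1] by linarith+
    qed
    moreover have "n * M = 2 * (n * (2 * pi * b)) + n * (2 * pi * (4 * b\<^sup>2))"
      by (simp add: M_def algebra_simps)
    ultimately have "\<bar>\<kappa> * (n * (n + 2)) / 2\<bar> \<le> n * M"
      by linarith
    moreover have "\<bar>\<kappa> * (n * (n + 2)) / 2\<bar> = n * (\<bar>\<kappa>\<bar> * (n + 2) / 2)"
      using n by (simp add: abs_mult)
    ultimately have "\<bar>\<kappa>\<bar> * (n + 2) / 2 \<le> M"
      using n by simp
    then show ?thesis using M by simp
  qed
  \<comment> \<open>For nonzero \<kappa> the left side is 3|\<kappa>| + 4M, a contradiction. For
    \<kappa> = 0 the quotient is 0 by convention and n = 1 is still admissible.\<close>
  from this[of "1 + 4 * M / \<bar>\<kappa>\<bar>"] have le: "\<bar>\<kappa>\<bar> * (1 + 4 * M / \<bar>\<kappa>\<bar> + 2) \<le> 4 * M"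
    using M by simp
  have "\<kappa> = 0"
  proof (rule ccontr)
    assume "\<kappa> \<noteq> 0"
    then have "\<bar>\<kappa>\<bar> * (1 + 4 * M / \<bar>\<kappa>\<bar> + 2) = 3 * \<bar>\<kappa>\<bar> + 4 * M" "0 < \<bar>\<kappa>\<bar>"
      by (simp_all add: distrib_left)
    then show False using le by linarith
  qed
  then show ?thesis using sigma by (simp add: \<kappa>_def)
qed

section \<open>Stream function and energy estimate\<close>

text \<open>The stream function of \<open>u\<close>; both of its derivatives are expressed by \<open>u\<close> itself, which is
  bounded, and not by derivatives of \<open>u\<close>.\<close>

definition psi :: "real \<Rightarrow> real \<Rightarrow> real" where "psi = primitive (rad u)"

lemma continuous_rad_u: "continuous_on UNIV (\<lambda>p. rad u (fst p) (snd p))"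
  by (rule continuous_rad[where k = 0]) (rule C1)

lemma continuous_tang_u: "continuous_on UNIV (\<lambda>p. tang \<sigma> u (fst p) (snd p))"
  by (rule continuous_tang[where k = 0]) (rule C1)

lemma continuous_tang_u_0: "continuous_on UNIV (\<lambda>p :: real \<times> real. tang \<sigma> u (fst p) 0)"
  using continuous_on_compose2[OF continuous_tang_u, of UNIV "\<lambda>p. (fst p, 0)"]
  by (simp add: continuous_on_Pair continuous_on_fst)

lemma continuous_psi: "continuous_on UNIV (\<lambda>p. psi (fst p) (snd p))"
  unfolding psi_def by (rule continuous_primitive[OF continuous_rad_u])

lemma psi_deriv_angular: "(psi r has_real_derivative rad u r t) (at t)"
  unfolding psi_def
proof (rule primitive_deriv)
  show "(rad u r has_real_derivative
      r * (\<sigma> * (cos t * partial 3 (u 1) (polar r t) + sin t * partial 3 (u 2) (polar r t)))) (at t)" for t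
    unfolding rad_def[abs_def]
    using radial_component_deriv[where F = u and k = 0, OF C1(1) hel_u] by (rule DERIV_cmult)
  show "continuous_on UNIV (rad u r)"
    by (rule continuous_on_section[OF continuous_rad_u])
  show "continuous_on UNIV
      (\<lambda>t. r * (\<sigma> * (cos t * partial 3 (u 1) (polar r t) + sin t * partial 3 (u 2) (polar r t))))"
    by (intro continuous_intros continuous_on_comp_polar Ck_continuous_on[OF C1(3)])
qed

text \<open>Incompressibility: the radial derivative of \<open>rad u\<close> is
  -\<open>tang' u\<close>, which integrates in the angle to a difference of values of
  \<open>tang\<close>. The value at angle 0 remains because \<open>psi\<close> is normalised
  there.\<close>

lemma psi_deriv_radial:
  "((\<lambda>r. psi r t) has_real_derivative tang \<sigma> u r 0 - tang \<sigma> u r t) (at r)"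
proof -
  have td: "(tang \<sigma> u r has_real_derivative tang' u r t) (at t)" for r t
    by (rule tang_deriv[where k = 0]) (simp_all only: sigma C1 hel not_False_eq_True)
  have "((\<lambda>r. integral {0..1} (\<lambda>s. rad u r (s * t))) has_real_derivative
      integral {0..1} (\<lambda>s. - tang' u r (s * t))) (at r)"
  proof (rule integral_param_deriv)
    show "((\<lambda>r. rad u r (s * t)) has_real_derivative - tang' u r (s * t)) (at r)" for r s
      using rad_deriv[where F = u and k = 0 and r = r and t = "s * t", OF C1(1)] by (simp add: div_u)
    have "continuous_on UNIV (\<lambda>p. tang' u (fst p) (snd p))"
      by (rule continuous_tang'[where k = 0]) (rule C1)
    then show "continuous_on UNIV (\<lambda>p. - tang' u (fst p) (snd p * t))"
      using continuous_on_compose2[of UNIV _ UNIV "\<lambda>p. (fst p, snd p * t)"]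
      by (fastforce intro!: continuous_intros)
    show "continuous_on UNIV (\<lambda>p. rad u (fst p) (snd p * t))"
      using continuous_on_compose2[OF continuous_rad_u, of UNIV "\<lambda>p. (fst p, snd p * t)"]
      by (fastforce intro!: continuous_intros)
  qed
  then have "((\<lambda>r. psi r t) has_real_derivative t * integral {0..1} (\<lambda>s. - tang' u r (s * t))) (at r)"
    unfolding psi_def primitive_def by (rule DERIV_cmult)
  moreover have "t * integral {0..1} (\<lambda>s. - tang' u r (s * t)) = tang \<sigma> u r 0 - tang \<sigma> u r t"
    using integral_scaled_deriv[OF td[of r], of t] by simp
  ultimately show ?thesis by simp
qed

lemma psi_0: "psi r 0 = 0"
  by (simp add: psi_def primitive_def)

text \<open>The stream function is single-valued on the circle because the flux of \<open>u\<close>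
  through it is 0.\<close>

lemma psi_2pi: "psi r (2 * pi) = 0"
proof -
  have "(rad u r has_integral (psi r (2*pi) - psi r 0)) {0..2*pi}"
    by (intro fundamental_theorem_of_calculus)
      (auto intro: has_field_derivative_at_within psi_deriv_angular
        simp flip: has_real_derivative_iff_has_vector_derivative)
  then have "psi r (2*pi) - psi r 0 = circ (rad u) r"
    by (simp add: circ_def integral_unique)
  also have "\<dots> = 0"
    by (rule circ_rad_eq_0[where k = 0 and \<sigma> = \<sigma>]) (simp_all only: sigma C1 hel div_u not_False_eq_True)
  finally show ?thesis by (simp add: psi_0)
qed

lemma circ_rad_pressure:
  "circ (\<lambda>r t. rad u r t * P (polar r t)) r = - \<sigma> * circ (\<lambda>r t. psi r t * partial 3 P (polar r t)) r"
proof -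
  note cont = continuous_rad_u continuous_psi continuous_on_polar_pair[OF P_C1]
    continuous_on_polar_pair[OF Ck_partial[OF P_C1]]
  \<comment> \<open>With c = 0 the angular derivative of P on the circle is purely axial.\<close>
  have dP: "((\<lambda>t. P (polar r t)) has_real_derivative \<sigma> * partial 3 P (polar r t)) (at t)" for t
    using polar_deriv_angular_killing[where f = P and \<sigma> = \<sigma> and r = r and t = t]
    by (simp add: killing_P pressure_drop_eq_0)
  have "circ (\<lambda>r t. psi r t * (\<sigma> * partial 3 P (polar r t)) + rad u r t * P (polar r t)) r = 0"
    by (rule circ_integral_deriv_eq_0[of "\<lambda>r t. psi r t * P (polar r t)"])
      (auto simp: psi_0 psi_2pi intro: DERIV_mult'[OF psi_deriv_angular dP])
  moreover have "circ (\<lambda>r t. \<sigma> * (psi r t * partial 3 P (polar r t)) + rad u r t * P (polar r t)) r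
      = \<sigma> * circ (\<lambda>r t. psi r t * partial 3 P (polar r t)) r + circ (\<lambda>r t. rad u r t * P (polar r t)) r"
    by (subst circ_add, (intro continuous_intros cont)+, subst circ_cmult, rule refl)
  ultimately show ?thesis
    by (simp add: mult.left_commute)
qed

lemma circ_rad_total:
  "circ (rad total_flux) r
    = circ (rad kinetic_flux) r + \<sigma> * circ (\<lambda>r t. psi r t * partial 3 P (polar r t)) r"
proof -
  have "circ (rad total_flux) r = circ (\<lambda>r t. rad kinetic_flux r t - rad u r t * P (polar r t)) r"
    unfolding circ_def by (rule integral_cong) (simp add: rad_def total_flux_def algebra_simps)
  also have "\<dots> = circ (rad kinetic_flux) r - circ (\<lambda>r t. rad u r t * P (polar r t)) r"
    by (rule circ_diff) (intro continuous_intros continuous_rad_u continuous_on_polar_pair[OF P_C1]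
      continuous_rad[where k = 0] C1_derived)+
  finally show ?thesis by (simp add: circ_rad_pressure)
qed

lemma total_flux_deriv:
  "(circ (rad total_flux) has_real_derivative r * circ (\<lambda>r t. dissip (polar r t)) r) (at r)"
  using flux_deriv[where F = total_flux and k = 0 and \<sigma> = \<sigma> and r = r]
  by (simp only: sigma C1_derived killing_total_flux[OF pressure_drop_eq_0] divg_total_flux simp_thms)

text \<open>The term grad psi . axial flux of \<open>weighted_flux_deriv\<close>, with both
  derivatives of \<open>psi\<close> already written through \<open>u\<close>.\<close>

definition corrector :: "real \<Rightarrow> real \<Rightarrow> real" where
  "corrector r t = (tang \<sigma> u r 0 - tang \<sigma> u r t) * rad axial_flux r t + rad u r t * tang \<sigma> axial_flux r t"

text \<open>Read backwards, this writes r times the pressure term of \<open>circ_rad_total\<close>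
  as an exact radial derivative minus \<open>circ corrector r\<close>.\<close>

lemma weighted_axial_flux_deriv:
  "(circ (\<lambda>r t. psi r t * rad axial_flux r t) has_real_derivative
    circ corrector r + r * circ (\<lambda>r t. psi r t * partial 3 P (polar r t)) r) (at r)"
proof -
  have "(circ (\<lambda>r t. psi r t * rad axial_flux r t) has_real_derivative
    circ (\<lambda>r t. (tang \<sigma> u r 0 - tang \<sigma> u r t) * rad axial_flux r t + rad u r t * tang \<sigma> axial_flux r t) r
    + r * circ (\<lambda>r t. psi r t * divg axial_flux (polar r t)) r) (at r)"
    by (rule weighted_flux_deriv[where k = 0])
      (auto intro!: psi_deriv_radial psi_deriv_angular continuous_psi continuous_rad_u
        continuous_intros continuous_tang_u continuous_tang_u_0
        simp only: sigma C1_derived killing_axial_flux psi_0 psi_2pi)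
  then show ?thesis
    by (simp add: divg_axial_flux corrector_def[abs_def])
qed

lemma continuous_corrector: "continuous_on UNIV (\<lambda>p. corrector (fst p) (snd p))"
  unfolding corrector_def
  by (intro continuous_intros continuous_rad_u continuous_tang_u continuous_tang_u_0
    continuous_rad[where k = 0] continuous_tang[where k = 0] C1_derived)

section \<open>Pointwise bounds for the fluxes and the corrector\<close>

lemma abs_tang_le:
  assumes "\<And>j. \<bar>F j (polar r t)\<bar> \<le> N" "1 \<le> r"
  shows "\<bar>tang \<sigma> F r t\<bar> \<le> r * (2 + 1 / \<bar>\<sigma>\<bar>) * N"
proof -
  have N: "0 \<le> N" using assms(1)[of 1] by linarith
  have "\<bar>tang \<sigma> F r t\<bar> \<le> 2 * N + r / \<bar>\<sigma>\<bar> * N"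
  proof -
    have "\<bar>r / \<sigma> * F 3 (polar r t)\<bar> \<le> r / \<bar>\<sigma>\<bar> * N"
      unfolding abs_mult using assms by (simp add: abs_divide divide_right_mono mult_left_mono)
    then show ?thesis
      unfolding tang_def using abs_cos_sin_le(2)[OF assms(1)[of 2] assms(1)[of 1], of t] by linarith
  qed
  also have "\<dots> \<le> r * (2 * N) + r / \<bar>\<sigma>\<bar> * N"
    using assms(2) N mult_right_mono[of 1 r "2 * N"] by simp
  finally show ?thesis by (simp add: algebra_simps)
qed

text \<open>Grouped so that each quadratic term contains a radial component; the two of them
  contribute 2 b |\<sigma>| \<open>circ_grad r\<close> each.\<close>

lemma abs_rad_axial_le:
  assumes "1 \<le> r" "t \<in> {0..2*pi}"
  shows "\<bar>rad axial_flux r t\<bar> \<le> r * (2 * grad_norm (polar r t) + 4 * b * \<bar>\<sigma>\<bar> * circ_grad r)"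
proof -
  let ?x = "polar r t"
  have eq: "rad axial_flux r t = r * ((cos t * partial 1 (u 3) ?x + sin t * partial 2 (u 3) ?x)
      - u 3 ?x * (cos t * u 1 ?x + sin t * u 2 ?x) + h 3 ?x * (cos t * h 1 ?x + sin t * h 2 ?x))"
    by (simp add: rad_def axial_flux_def algebra_simps)
  have r: "r \<noteq> 0" using assms by simp
  have "\<bar>cos t * partial 1 (u 3) ?x + sin t * partial 2 (u 3) ?x\<bar> \<le> 2 * grad_norm ?x"
    by (intro abs_cos_sin_le partial_le_grad_norm)
  moreover have "\<bar>u 3 ?x * (cos t * u 1 ?x + sin t * u 2 ?x)\<bar> \<le> b * (2 * \<bar>\<sigma>\<bar> * circ_grad r)"
    "\<bar>h 3 ?x * (cos t * h 1 ?x + sin t * h 2 ?x)\<bar> \<le> b * (2 * \<bar>\<sigma>\<bar> * circ_grad r)"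
    by (intro abs_mult_bound bound_u bound_h radial_le_circ_grad r assms(2))+
  ultimately show ?thesis
    unfolding eq abs_mult[of r] using assms(1)
    by (simp only: abs_of_nonneg[OF order_trans[OF zero_le_one assms(1)]], intro mult_left_mono) linarith+
qed

text \<open>\<open>grad_energy\<close> consists of six products, and the combination with cos and
  sin doubles the bound: 12 b. \<open>energy\<close> and \<open>cross\<close> are at most 3 b^2,
  each multiplied by a radial component: 2 * 3 * 2 = 12.\<close>

lemma abs_rad_kinetic_le:
  assumes "1 \<le> r" "t \<in> {0..2*pi}"
  shows "\<bar>rad kinetic_flux r t\<bar> \<le> r * (12 * b * grad_norm (polar r t) + 12 * b\<^sup>2 * \<bar>\<sigma>\<bar> * circ_grad r)"
proof -
  let ?x = "polar r t"
  have eq: "rad kinetic_flux r t = r * ((cos t * grad_energy 1 ?x + sin t * grad_energy 2 ?x)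
      - energy ?x * (cos t * u 1 ?x + sin t * u 2 ?x) + cross ?x * (cos t * h 1 ?x + sin t * h 2 ?x))"
    by (simp add: rad_def kinetic_flux_def algebra_simps)
  have r: "r \<noteq> 0" using assms by simp
  have "\<bar>grad_energy i ?x\<bar> \<le> 6 * (b * grad_norm ?x)" for i
  proof -
    have "\<bar>u j ?x * partial i (u j) ?x\<bar> \<le> b * grad_norm ?x" "\<bar>h j ?x * partial i (h j) ?x\<bar> \<le> b * grad_norm ?x" for j
      by (intro abs_mult_bound bound_u bound_h partial_le_grad_norm)+
    from this[of 1] this[of 2] this[of 3] show ?thesis
      unfolding grad_energy_def by linarith
  qed
  then have "\<bar>cos t * grad_energy 1 ?x + sin t * grad_energy 2 ?x\<bar> \<le> 2 * (6 * (b * grad_norm ?x))"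
    by (intro abs_cos_sin_le)
  moreover have ec: "\<bar>energy ?x\<bar> \<le> 3 * b\<^sup>2" "\<bar>cross ?x\<bar> \<le> 3 * b\<^sup>2"
  proof -
    have "\<bar>u j ?x * u j ?x\<bar> \<le> b * b" "\<bar>h j ?x * h j ?x\<bar> \<le> b * b" "\<bar>u j ?x * h j ?x\<bar> \<le> b * b" for j
      by (intro abs_mult_bound bound_u bound_h)+
    note le = this
    show "\<bar>cross ?x\<bar> \<le> 3 * b\<^sup>2"
      unfolding cross_def power2_eq_square using le(3)[of 1] le(3)[of 2] le(3)[of 3] by linarith
    have "0 \<le> energy ?x"
      unfolding energy_def by (intro mult_nonneg_nonneg add_nonneg_nonneg zero_le_square) simp
    moreover have "energy ?x \<le> 3 * b\<^sup>2"
      unfolding energy_def power2_eq_square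
      using le(1,2)[THEN abs_le_D1, of 1] le(1,2)[THEN abs_le_D1, of 2] le(1,2)[THEN abs_le_D1, of 3]
      by simp
    ultimately show "\<bar>energy ?x\<bar> \<le> 3 * b\<^sup>2" by simp
  qed
  have "\<bar>energy ?x * (cos t * u 1 ?x + sin t * u 2 ?x)\<bar> \<le> 3 * b\<^sup>2 * (2 * \<bar>\<sigma>\<bar> * circ_grad r)"
    "\<bar>cross ?x * (cos t * h 1 ?x + sin t * h 2 ?x)\<bar> \<le> 3 * b\<^sup>2 * (2 * \<bar>\<sigma>\<bar> * circ_grad r)"
    by (intro abs_mult_bound ec radial_le_circ_grad r assms(2))+
  ultimately show ?thesis
    unfolding eq abs_mult[of r] using assms(1)
    by (simp only: abs_of_nonneg[OF order_trans[OF zero_le_one assms(1)]], intro mult_left_mono) linarith+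
qed

lemma abs_corrector_le:
  assumes "1 \<le> r" "t \<in> {0..2*pi}"
  defines "m \<equiv> 2 + 1 / \<bar>\<sigma>\<bar>"
  shows "\<bar>corrector r t\<bar> \<le> r\<^sup>2 * (6 * m * b) * grad_norm (polar r t) + r\<^sup>2 * (12 * m * b\<^sup>2 * \<bar>\<sigma>\<bar>) * circ_grad r"
proof -
  let ?x = "polar r t"
  let ?ur = "cos t * u 1 ?x + sin t * u 2 ?x"
  have r: "r \<noteq> 0" "0 \<le> r" using assms by auto
  have m: "0 \<le> m" by (simp add: m_def)
  have "\<bar>tang \<sigma> u r t'\<bar> \<le> r * m * b" for t'
    unfolding m_def by (intro abs_tang_le bound_u assms)
  from this[of 0] this[of t] have "\<bar>tang \<sigma> u r 0 - tang \<sigma> u r t\<bar> \<le> 2 * (r * m * b)"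
    by linarith
  then have 1: "\<bar>(tang \<sigma> u r 0 - tang \<sigma> u r t) * rad axial_flux r t\<bar>
      \<le> 2 * (r * m * b) * (r * (2 * grad_norm ?x + 4 * b * \<bar>\<sigma>\<bar> * circ_grad r))"
    by (intro abs_mult_bound abs_rad_axial_le assms)
  have "\<bar>axial_flux j ?x\<bar> \<le> grad_norm ?x + 2 * b\<^sup>2" for j
  proof -
    have "\<bar>u j ?x * u 3 ?x\<bar> \<le> b * b" "\<bar>h j ?x * h 3 ?x\<bar> \<le> b * b"
      by (intro abs_mult_bound bound_u bound_h)+
    then show ?thesis
      unfolding axial_flux_def power2_eq_square using partial_le_grad_norm(1)[of j 3 ?x] by linarith
  qed
  then have "\<bar>tang \<sigma> axial_flux r t\<bar> \<le> r * m * (grad_norm ?x + 2 * b\<^sup>2)"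
    unfolding m_def by (intro abs_tang_le assms)
  then have "\<bar>?ur * tang \<sigma> axial_flux r t\<bar> \<le> \<bar>?ur\<bar> * (r * m * (grad_norm ?x + 2 * b\<^sup>2))"
    by (intro abs_mult_bound) auto
  also have "\<dots> = r * m * (\<bar>?ur\<bar> * grad_norm ?x + 2 * b\<^sup>2 * \<bar>?ur\<bar>)"
    by (simp add: algebra_simps)
  \<comment> \<open>The radial velocity is bounded in two ways: by 2b where a gradient stands beside
    it, and by \<open>circ_grad\<close> where only b^2 does.\<close>
  also have "\<dots> \<le> r * m * (2 * b * grad_norm ?x + 2 * b\<^sup>2 * (2 * \<bar>\<sigma>\<bar> * circ_grad r))"
    using r m
    by (intro mult_left_mono add_mono mult_right_mono abs_cos_sin_le bound_u radial_le_circ_grad assms grad_norm_nonneg) auto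
  finally have "r * \<bar>?ur * tang \<sigma> axial_flux r t\<bar> \<le> r * (r * m * (2 * b * grad_norm ?x + 2 * b\<^sup>2 * (2 * \<bar>\<sigma>\<bar> * circ_grad r)))"
    using r by (intro mult_left_mono) auto
  moreover have "\<bar>rad u r t * tang \<sigma> axial_flux r t\<bar> = r * \<bar>?ur * tang \<sigma> axial_flux r t\<bar>"
    using r by (simp add: rad_def abs_mult)
  ultimately have 2: "\<bar>rad u r t * tang \<sigma> axial_flux r t\<bar>
      \<le> r * (r * m * (2 * b * grad_norm ?x + 2 * b\<^sup>2 * (2 * \<bar>\<sigma>\<bar> * circ_grad r)))" by simp
  have "\<bar>corrector r t\<bar> \<le> 2 * (r * m * b) * (r * (2 * grad_norm ?x + 4 * b * \<bar>\<sigma>\<bar> * circ_grad r))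
      + r * (r * m * (2 * b * grad_norm ?x + 2 * b\<^sup>2 * (2 * \<bar>\<sigma>\<bar> * circ_grad r)))"
    unfolding corrector_def using 1 2 by linarith
  also have "\<dots> = r\<^sup>2 * (6 * m * b) * grad_norm ?x + r\<^sup>2 * (12 * m * b\<^sup>2 * \<bar>\<sigma>\<bar>) * circ_grad r"
    by (simp add: power2_eq_square algebra_simps)
  finally show ?thesis .
qed

lemma abs_psi_rad_le:
  assumes "1 \<le> r" "t \<in> {0..2*pi}"
  shows "\<bar>psi r t * rad axial_flux r t\<bar>
    \<le> r\<^sup>2 * (8 * pi * b) * grad_norm (polar r t) + r\<^sup>2 * (16 * pi * b\<^sup>2 * \<bar>\<sigma>\<bar>) * circ_grad r"
proof -
  have "\<bar>rad u r t'\<bar> \<le> r * (2 * b)" for t'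
    unfolding rad_def using assms by (intro abs_mult_bound abs_cos_sin_le bound_u) auto
  then have "\<bar>psi r t\<bar> \<le> t * (r * (2 * b))"
    unfolding psi_def using assms by (intro primitive_abs_le continuous_on_section[OF continuous_rad_u]) auto
  also have "\<dots> \<le> 2 * pi * (r * (2 * b))"
    using assms b_nonneg by (intro mult_right_mono) auto
  finally have "\<bar>psi r t * rad axial_flux r t\<bar>
      \<le> 2 * pi * (r * (2 * b)) * (r * (2 * grad_norm (polar r t) + 4 * b * \<bar>\<sigma>\<bar> * circ_grad r))"
    by (intro abs_mult_bound abs_rad_axial_le assms)
  then show ?thesis
    by (simp add: power2_eq_square algebra_simps)
qed

text \<open>Young's inequality x \<le> a x^2 + 1/(4a) with a = t r, integrated over the circle; 2
  pi/(4a) \<le> 2/a since pi < 4. It replaces Cauchy-Schwarz and keeps t free.\<close>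

lemma circ_grad_le:
  assumes "1 \<le> r" "0 < t"
  shows "circ_grad r \<le> t * (r * circ (\<lambda>r t. dissip (polar r t)) r) + 2 / (t * r)"
proof -
  define a where "a = t * r"
  have a: "0 < a" using assms by (simp add: a_def)
  have "grad_norm x \<le> a * dissip x + 1 / (4 * a)" for x
  proof -
    have D: "dissip x = (grad_norm x)\<^sup>2" by (simp add: grad_norm_def dissip_nonneg)
    have "0 \<le> (2 * a * grad_norm x - 1)\<^sup>2 / (4 * a)" using a by simp
    also have "\<dots> = a * (grad_norm x)\<^sup>2 + 1 / (4 * a) - grad_norm x"
      using a by (simp add: power2_eq_square field_simps)
    finally show ?thesis by (simp add: D)
  qed
  then have "circ_grad r \<le> circ (\<lambda>r t. a * dissip (polar r t) + 1 / (4 * a)) r"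
    unfolding circ_grad_def by (intro circ_mono continuous_intros continuous_grad_norm_polar continuous_dissip_polar)
  also have "\<dots> = a * circ (\<lambda>r t. dissip (polar r t)) r + 2 * pi * (1 / (4 * a))"
    by (subst circ_add, (intro continuous_intros continuous_dissip_polar)+, subst circ_cmult, simp)
  also have "2 * pi * (1 / (4 * a)) \<le> 2 / a"
    using a pi_less_4 by (simp add: field_simps)
  finally show ?thesis by (simp add: a_def mult.assoc)
qed

text \<open>The energy flux plays the role of E: it vanishes at radius 0 and its derivative is the
  dissipation on the circle.\<close>

lemma circ_rad_total_eq_0:
  assumes "0 \<le> r"
  shows "circ (rad total_flux) r = 0"
proof -
  define m where "m = 2 + 1 / \<bar>\<sigma>\<bar>"
  define K1 where "K1 = 12 * b + 2 * pi * (12 * b\<^sup>2 * \<bar>\<sigma>\<bar>)"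
  define K2 where "K2 = 6 * m * b + 2 * pi * (12 * m * b\<^sup>2 * \<bar>\<sigma>\<bar>)"
  define K3 where "K3 = 8 * pi * b + 2 * pi * (16 * pi * b\<^sup>2 * \<bar>\<sigma>\<bar>)"
  define C where "C = K1 + \<bar>\<sigma>\<bar> * K2 + \<bar>\<sigma>\<bar> * K3"
  have K: "0 \<le> K1" "0 \<le> K2" "0 \<le> K3"
    unfolding K1_def K2_def K3_def m_def using b_nonneg by (intro add_nonneg_nonneg mult_nonneg_nonneg; simp)+
  note cont = continuous_rad[where F = kinetic_flux, OF C1_derived(4)]
    continuous_rad[where F = axial_flux, OF C1_derived(6)] continuous_corrector continuous_psi
  have k1: "\<bar>r * circ (rad kinetic_flux) r\<bar> \<le> K1 * r\<^sup>2 * circ_grad r" if "1 \<le> r" for r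
  proof -
    have "\<bar>circ (rad kinetic_flux) r\<bar> \<le> (r * (12 * b) + 2 * pi * (r * (12 * b\<^sup>2 * \<bar>\<sigma>\<bar>))) * circ_grad r"
      using abs_rad_kinetic_le[OF that] by (intro circ_abs_le_circ_grad cont) (simp add: algebra_simps)
    then have "\<bar>r * circ (rad kinetic_flux) r\<bar> \<le> r * ((r * (12 * b) + 2 * pi * (r * (12 * b\<^sup>2 * \<bar>\<sigma>\<bar>))) * circ_grad r)"
      using that by (intro abs_mult_bound) auto
    also have "\<dots> = K1 * r\<^sup>2 * circ_grad r"
      by (simp add: K1_def power2_eq_square algebra_simps)
    finally show ?thesis .
  qed
  have k2: "\<bar>\<sigma> * circ corrector r\<bar> \<le> \<bar>\<sigma>\<bar> * K2 * r\<^sup>2 * circ_grad r" if "1 \<le> r" for r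
  proof -
    have "\<bar>circ corrector r\<bar> \<le> (r\<^sup>2 * (6 * m * b) + 2 * pi * (r\<^sup>2 * (12 * m * b\<^sup>2 * \<bar>\<sigma>\<bar>))) * circ_grad r"
      using abs_corrector_le[OF that] unfolding m_def by (intro circ_abs_le_circ_grad cont)
    then have "\<bar>\<sigma> * circ corrector r\<bar> \<le> \<bar>\<sigma>\<bar> * ((r\<^sup>2 * (6 * m * b) + 2 * pi * (r\<^sup>2 * (12 * m * b\<^sup>2 * \<bar>\<sigma>\<bar>))) * circ_grad r)"
      by (intro abs_mult_bound) auto
    also have "\<dots> = \<bar>\<sigma>\<bar> * K2 * r\<^sup>2 * circ_grad r"
      by (simp add: K2_def algebra_simps)
    finally show ?thesis .
  qed
  have k3: "\<bar>\<sigma> * circ (\<lambda>r t. psi r t * rad axial_flux r t) r\<bar> \<le> \<bar>\<sigma>\<bar> * K3 * r\<^sup>2 * circ_grad r" if "1 \<le> r" for r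
  proof -
    have "\<bar>circ (\<lambda>r t. psi r t * rad axial_flux r t) r\<bar>
        \<le> (r\<^sup>2 * (8 * pi * b) + 2 * pi * (r\<^sup>2 * (16 * pi * b\<^sup>2 * \<bar>\<sigma>\<bar>))) * circ_grad r"
      using abs_psi_rad_le[OF that] by (intro circ_abs_le_circ_grad continuous_intros cont)
    then have "\<bar>\<sigma> * circ (\<lambda>r t. psi r t * rad axial_flux r t) r\<bar>
        \<le> \<bar>\<sigma>\<bar> * ((r\<^sup>2 * (8 * pi * b) + 2 * pi * (r\<^sup>2 * (16 * pi * b\<^sup>2 * \<bar>\<sigma>\<bar>))) * circ_grad r)"
      by (intro abs_mult_bound) auto
    also have "\<dots> = \<bar>\<sigma>\<bar> * K3 * r\<^sup>2 * circ_grad r"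
      by (simp add: K3_def algebra_simps)
    finally show ?thesis .
  qed
  have pos: "0 \<le> r\<^sup>2 * circ_grad r" for r
    using circ_grad_nonneg by simp
  have C: "K1 * r\<^sup>2 * circ_grad r + \<bar>\<sigma>\<bar> * K2 * r\<^sup>2 * circ_grad r \<le> C * r\<^sup>2 * circ_grad r" "\<bar>\<sigma>\<bar> * K3 * r\<^sup>2 * circ_grad r \<le> C * r\<^sup>2 * circ_grad r" for r
    using mult_nonneg_nonneg[OF K(1) pos[of r]] mult_nonneg_nonneg[OF mult_nonneg_nonneg[OF abs_ge_zero K(2)] pos, of \<sigma> r]
      mult_nonneg_nonneg[OF mult_nonneg_nonneg[OF abs_ge_zero K(3)] pos, of \<sigma> r]
    unfolding C_def by (simp_all add: algebra_simps)
  show ?thesis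
  proof (rule energy_eq_0[where E = "circ (rad total_flux)" and r = r and C = C and S = circ_grad
        and e = "\<lambda>r. r * circ (\<lambda>r t. dissip (polar r t)) r"
        and g = "\<lambda>r. \<sigma> * circ (\<lambda>r t. psi r t * rad axial_flux r t) r"
        and g' = "\<lambda>r. \<sigma> * (circ corrector r + r * circ (\<lambda>r t. psi r t * partial 3 P (polar r t)) r)"
        and \<kappa> = "\<lambda>r. r * circ (rad kinetic_flux) r - \<sigma> * circ corrector r"])
    show "0 \<le> C" using K by (simp add: C_def)
    show "(circ (rad total_flux) has_real_derivative r * circ (\<lambda>r t. dissip (polar r t)) r) (at r)" for r
      by (rule total_flux_deriv)
    show "0 \<le> r * circ (\<lambda>r t. dissip (polar r t)) r" if "0 \<le> r" for r
      unfolding circ_def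
      by (intro mult_nonneg_nonneg that integral_nonneg integrable_section[of "\<lambda>r t. dissip (polar r t)"]
          continuous_dissip_polar dissip_nonneg)
    show "circ (rad total_flux) 0 = 0"
      by (simp add: circ_def rad_def[abs_def])
    show "continuous_on UNIV (\<lambda>r. r * circ (\<lambda>r t. dissip (polar r t)) r)"
      by (intro continuous_intros continuous_circ continuous_dissip_polar)
    show "continuous_on UNIV circ_grad"
      unfolding circ_grad_def by (intro continuous_circ continuous_grad_norm_polar)
    show "((\<lambda>r. \<sigma> * circ (\<lambda>r t. psi r t * rad axial_flux r t) r) has_real_derivative
        \<sigma> * (circ corrector r + r * circ (\<lambda>r t. psi r t * partial 3 P (polar r t)) r)) (at r)" for r
      by (intro DERIV_cmult weighted_axial_flux_deriv)
    \<comment> \<open>The corrector is subtracted in \<kappa> and restored in g', leaving r times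
      \<open>circ_rad_total\<close>.\<close>
    show "r * circ (rad total_flux) r = r * circ (rad kinetic_flux) r - \<sigma> * circ corrector r
        + \<sigma> * (circ corrector r + r * circ (\<lambda>r t. psi r t * partial 3 P (polar r t)) r)" for r
      unfolding circ_rad_total by (simp add: algebra_simps)
    show "continuous_on {1..} (\<lambda>r. r * circ (rad kinetic_flux) r - \<sigma> * circ corrector r)"
      by (intro continuous_intros continuous_circ cont)
    show "\<bar>r * circ (rad kinetic_flux) r - \<sigma> * circ corrector r\<bar> \<le> C * r\<^sup>2 * circ_grad r" if "1 \<le> r" for r
      using k1[OF that] k2[OF that] C(1)[of r] by linarith
    show "\<bar>\<sigma> * circ (\<lambda>r t. psi r t * rad axial_flux r t) r\<bar> \<le> C * r\<^sup>2 * circ_grad r" if "1 \<le> r" for r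
      using k3[OF that] C(2)[of r] by linarith
    show "circ_grad r \<le> t * (r * circ (\<lambda>r t. dissip (polar r t)) r) + 2 / (t * r)" if "1 \<le> r" "0 < t" for r t
      by (rule circ_grad_le[OF that])
  qed (rule assms)
qed

text \<open>E is 0 on the half-line, so its derivative at r > 0 is 0; a continuous nonnegative
  integrand with zero integral vanishes.\<close>

lemma dissip_polar_eq_0:
  assumes "0 < r" "t \<in> {0..2*pi}"
  shows "dissip (polar r t) = 0"
proof -
  have "r * circ (\<lambda>r t. dissip (polar r t)) r = 0"
  proof (rule DERIV_unique[OF total_flux_deriv])
    have "((\<lambda>r. 0) has_real_derivative 0) (at r)" by simp
    then show "(circ (rad total_flux) has_real_derivative 0) (at r)"
      by (rule has_field_derivative_transform_within_open[where S = "{0<..}"])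
        (use assms circ_rad_total_eq_0 in auto)
  qed
  then have "integral {0..2*pi} (\<lambda>t. dissip (polar r t)) = 0"
    using assms by (simp add: circ_def)
  moreover have "continuous_on {0..2*pi} (\<lambda>t. dissip (polar r t))"
    by (rule continuous_on_section[of "\<lambda>r t. dissip (polar r t)"]) (rule continuous_dissip_polar)
  ultimately show ?thesis
    using integral_eq_0_iff[of 0 "2*pi" "\<lambda>t. dissip (polar r t)"] dissip_nonneg assms(2) by auto
qed

end

section \<open>Helical symmetry\<close>

lemma polar_exists:
  assumes "x $ 3 = 0"
  shows "\<exists>r t. 0 \<le> r \<and> t \<in> {0..2*pi} \<and> x = polar r t"
proof -
  define z where "z = Complex (x $ 1) (x $ 2)"
  let ?e = "of_real (cmod z) * exp (\<i> * of_real (Arg2pi z))"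
  have "Re ?e = cmod z * cos (Arg2pi z)" "Im ?e = cmod z * sin (Arg2pi z)"
    by (simp_all add: Re_exp Im_exp)
  then have "Re z = cmod z * cos (Arg2pi z)" "Im z = cmod z * sin (Arg2pi z)"
    using Arg2pi_eq[of z] by metis+
  then have "x $ 1 = cmod z * cos (Arg2pi z)" "x $ 2 = cmod z * sin (Arg2pi z)"
    by (metis z_def complex.sel)+
  then have "x = polar (cmod z) (Arg2pi z)"
    using assms unfolding vec_eq_iff forall_3 by simp
  moreover have "Arg2pi z \<in> {0..2*pi}"
    using Arg2pi_ge_0[of z] Arg2pi_lt_2pi[of z] by simp
  ultimately show ?thesis
    by (intro exI[of _ "cmod z"] exI[of _ "Arg2pi z"] conjI norm_ge_zero)
qed

lemma (in helical_mhd) partials_plane_eq_0: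
  assumes "x $ 3 = 0"
  shows "partial i (u j) x = 0" "partial i (h j) x = 0"
proof -
  obtain r t where rt: "0 \<le> r" "t \<in> {0..2*pi}" "x = polar r t"
    using polar_exists[OF assms] by (elim exE conjE)
  \<comment> \<open>The radius 0 is reached by continuity along the ray.\<close>
  have "continuous_on (closure {0<..}) (\<lambda>r. dissip (polar r t))"
    by (rule continuous_on_comp_polar[OF continuous_dissip continuous_on_id continuous_on_const])
  moreover have "dissip (polar r t) = 0" if "r \<in> {0<..}" for r
    using that rt(2) by (intro dissip_polar_eq_0) simp_all
  moreover have "r \<in> closure {0<..}"
    using rt(1) by simp
  ultimately have "dissip (polar r t) = 0"
    by (rule continuous_constant_on_closure[of _ "\<lambda>r. dissip (polar r t)"])
  then have "grad_norm x = 0" unfolding grad_norm_def rt(3) by simp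
  then have "\<bar>partial i (u j) x\<bar> \<le> 0" "\<bar>partial i (h j) x\<bar> \<le> 0"
    using partial_le_grad_norm[of i j x] by simp_all
  then show "partial i (u j) x = 0" "partial i (h j) x = 0"
    by simp_all
qed

section \<open>Action of the screw motions on points, derivatives and fields\<close>

lemma helS_nth:
  "helS \<sigma> \<rho> x $ 1 = cos \<rho> * x $ 1 + sin \<rho> * x $ 2"
  "helS \<sigma> \<rho> x $ 2 = - sin \<rho> * x $ 1 + cos \<rho> * x $ 2"
  "helS \<sigma> \<rho> x $ 3 = x $ 3 + \<sigma> * \<rho>"
  by (simp_all add: helS_def rotR_def matrix_vector_mult_def sum_3)

lemma helS_0 [simp]: "helS \<sigma> 0 x = x"
  by (simp add: vec_eq_iff forall_3 helS_nth)

lemma helS_plane: "\<sigma> \<noteq> 0 \<Longrightarrow> \<exists>\<rho> y. y $ 3 = 0 \<and> x = helS \<sigma> \<rho> y"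
proof (intro exI conjI)
  let ?\<rho> = "x $ 3 / \<sigma>"
  let ?y = "helS \<sigma> (- ?\<rho>) x"
  assume \<sigma>: "\<sigma> \<noteq> 0"
  show "?y $ 3 = 0" using \<sigma> by (simp add: helS_nth)
  have "cos ?\<rho> * (cos ?\<rho> * a - sin ?\<rho> * b) + sin ?\<rho> * (sin ?\<rho> * a + cos ?\<rho> * b) = a"
    "- sin ?\<rho> * (cos ?\<rho> * a - sin ?\<rho> * b) + cos ?\<rho> * (sin ?\<rho> * a + cos ?\<rho> * b) = b" for a b
    using sin_cos_squared_add[of ?\<rho>] by algebra+
  then show "x = helS \<sigma> ?\<rho> ?y"
    using \<sigma> by (simp add: vec_eq_iff forall_3 helS_nth)
qed

lemma has_derivative_helS: "(helS \<sigma> \<rho> has_derivative (\<lambda>v. rotR \<rho> *v v)) (at x)"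
  unfolding helS_def[abs_def]
  by (auto intro!: derivative_eq_intros
      bounded_linear.has_derivative[OF matrix_vector_mul_bounded_linear])

lemma comp_helS_differentiable:
  assumes "\<And>x. f differentiable (at x)"
  shows "(\<lambda>x. f (helS \<sigma> \<rho> x)) differentiable (at x)"
  using has_derivative_compose[OF has_derivative_helS has_derivative_partial[OF assms]]
  by (rule differentiableI)

lemma partial_comp_helS:
  fixes f :: "real^3 \<Rightarrow> real" and \<sigma> \<rho> :: real
  assumes "\<And>x. f differentiable (at x)"
  defines "y \<equiv> helS \<sigma> \<rho>"
  shows "partial 1 (\<lambda>x. f (y x)) = (\<lambda>x. cos \<rho> * partial 1 f (y x) - sin \<rho> * partial 2 f (y x))"
    and "partial 2 (\<lambda>x. f (y x)) = (\<lambda>x. sin \<rho> * partial 1 f (y x) + cos \<rho> * partial 2 f (y x))"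
    and "partial 3 (\<lambda>x. f (y x)) = (\<lambda>x. partial 3 f (y x))"
proof -
  have "partial i (\<lambda>x. f (y x)) x = (\<Sum>j\<in>UNIV. (rotR \<rho> *v axis i 1) $ j *\<^sub>R partial j f (y x))" for i x
    unfolding y_def
    by (rule partial_eqI[OF has_derivative_compose[OF has_derivative_helS has_derivative_partial[OF assms(1)]]])
  then show "partial 1 (\<lambda>x. f (y x)) = (\<lambda>x. cos \<rho> * partial 1 f (y x) - sin \<rho> * partial 2 f (y x))"
    "partial 2 (\<lambda>x. f (y x)) = (\<lambda>x. sin \<rho> * partial 1 f (y x) + cos \<rho> * partial 2 f (y x))"
    "partial 3 (\<lambda>x. f (y x)) = (\<lambda>x. partial 3 f (y x))"
    by (auto simp: sum_3 rotR_def matrix_vector_mult_def axis_def)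
qed

lemma partial_helS:
  fixes f :: "real^3 \<Rightarrow> real" and \<sigma> \<rho> :: real
  assumes "\<And>x. f differentiable (at x)"
  defines "y \<equiv> helS \<sigma> \<rho>"
  shows "partial 1 f (y x) = cos \<rho> * partial 1 (\<lambda>x. f (y x)) x + sin \<rho> * partial 2 (\<lambda>x. f (y x)) x"
    and "partial 2 f (y x) = - sin \<rho> * partial 1 (\<lambda>x. f (y x)) x + cos \<rho> * partial 2 (\<lambda>x. f (y x)) x"
    and "partial 3 f (y x) = partial 3 (\<lambda>x. f (y x)) x"
proof -
  have sc: "(sin \<rho>)\<^sup>2 + (cos \<rho>)\<^sup>2 = 1" by simp
  show "partial 1 f (y x) = cos \<rho> * partial 1 (\<lambda>x. f (y x)) x + sin \<rho> * partial 2 (\<lambda>x. f (y x)) x"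
    unfolding y_def partial_comp_helS[OF assms(1)] using sc by algebra
  show "partial 2 f (y x) = - sin \<rho> * partial 1 (\<lambda>x. f (y x)) x + cos \<rho> * partial 2 (\<lambda>x. f (y x)) x"
    unfolding y_def partial_comp_helS[OF assms(1)] using sc by algebra
  show "partial 3 f (y x) = partial 3 (\<lambda>x. f (y x)) x"
    unfolding y_def partial_comp_helS[OF assms(1)] ..
qed

lemma partial_lincomb:
  fixes f g :: "real^3 \<Rightarrow> real"
  assumes "\<And>x. f differentiable (at x)" "\<And>x. g differentiable (at x)"
  shows "partial i (\<lambda>x. a * f x + b * g x) = (\<lambda>x. a * partial i f x + b * partial i g x)"
  using assms by (auto simp: partial_add partial_mult differentiable_mult)

text \<open>The motions are rigid: the mixed second derivatives occur with opposite signs in the two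
  horizontal terms and cancel.\<close>

lemma laplacian_comp_helS:
  fixes f :: "real^3 \<Rightarrow> real"
  assumes "Ck (Suc (Suc 0)) f"
  shows "laplacian (\<lambda>x. f (helS \<sigma> \<rho> x)) x = laplacian f (helS \<sigma> \<rho> x)"
proof -
  have d: "f differentiable (at x)" "partial i f differentiable (at x)" for x i
    using assms(1) by auto
  have c: "(\<lambda>x. partial i f (helS \<sigma> \<rho> x)) differentiable (at x)" for i x
    by (rule comp_helS_differentiable) (rule d)
  define y where "y = helS \<sigma> \<rho>"
  have D: "partial i (\<lambda>x. p * partial j f (y x) + q * partial k f (y x)) x
      = p * partial i (\<lambda>x. partial j f (y x)) x + q * partial i (\<lambda>x. partial k f (y x)) x" for i j k p q
    using partial_lincomb[of "\<lambda>x. partial j f (y x)" "\<lambda>x. partial k f (y x)"] c by (simp add: y_def)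
  have 1: "partial 1 (partial 1 (\<lambda>x. f (y x))) x
      = cos \<rho> * (cos \<rho> * partial 1 (partial 1 f) (y x) - sin \<rho> * partial 2 (partial 1 f) (y x))
      - sin \<rho> * (cos \<rho> * partial 1 (partial 2 f) (y x) - sin \<rho> * partial 2 (partial 2 f) (y x))"
    using D[of 1 "cos \<rho>" 1 "- sin \<rho>" 2]
    by (simp add: y_def partial_comp_helS[OF d(1)] partial_comp_helS[OF d(2)])
  have 2: "partial 2 (partial 2 (\<lambda>x. f (y x))) x
      = sin \<rho> * (sin \<rho> * partial 1 (partial 1 f) (y x) + cos \<rho> * partial 2 (partial 1 f) (y x))
      + cos \<rho> * (sin \<rho> * partial 1 (partial 2 f) (y x) + cos \<rho> * partial 2 (partial 2 f) (y x))"
    using D[of 2 "sin \<rho>" 1 "cos \<rho>" 2]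
    by (simp add: y_def partial_comp_helS[OF d(1)] partial_comp_helS[OF d(2)])
  have 3: "partial 3 (partial 3 (\<lambda>x. f (y x))) x = partial 3 (partial 3 f) (y x)"
    by (simp add: y_def partial_comp_helS[OF d(1)] partial_comp_helS[OF d(2)])
  show ?thesis
    unfolding laplacian_def sum_3 y_def[symmetric] 1 2 3
    using sin_cos_squared_add[of \<rho>] by algebra
qed

lemma laplacian_lincomb:
  fixes f g :: "real^3 \<Rightarrow> real"
  assumes "Ck (Suc (Suc 0)) f" "Ck (Suc (Suc 0)) g"
  shows "laplacian (\<lambda>x. a * f x + b * g x) x = a * laplacian f x + b * laplacian g x"
  using assms unfolding laplacian_def
  by (simp add: partial_lincomb sum.distrib sum_distrib_left)

text \<open>Stated as equality of functions, so that it can be rewritten under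
  \<open>partial\<close> and \<open>laplacian\<close>.\<close>

definition helical_group :: "real \<Rightarrow> (3 \<Rightarrow> real^3 \<Rightarrow> real) \<Rightarrow> bool" where
  "helical_group \<sigma> v \<longleftrightarrow> (\<forall>\<rho>.
    (\<lambda>x. v 1 (helS \<sigma> \<rho> x)) = (\<lambda>x. cos \<rho> * v 1 x + sin \<rho> * v 2 x) \<and>
    (\<lambda>x. v 2 (helS \<sigma> \<rho> x)) = (\<lambda>x. - sin \<rho> * v 1 x + cos \<rho> * v 2 x) \<and>
    (\<lambda>x. v 3 (helS \<sigma> \<rho> x)) = (\<lambda>x. v 3 x))"

lemma helical_groupD:
  assumes "helical_group \<sigma> v"
  shows "(\<lambda>x. v 1 (helS \<sigma> \<rho> x)) = (\<lambda>x. cos \<rho> * v 1 x + sin \<rho> * v 2 x)"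
    "(\<lambda>x. v 2 (helS \<sigma> \<rho> x)) = (\<lambda>x. - sin \<rho> * v 1 x + cos \<rho> * v 2 x)"
    "(\<lambda>x. v 3 (helS \<sigma> \<rho> x)) = v 3"
  using assms unfolding helical_group_def by auto

lemma helical_group_nth:
  assumes "helically_symmetric \<sigma> v"
  shows "helical_group \<sigma> (\<lambda>j x. v x $ j)"
  using assms unfolding helical_group_def helically_symmetric_def
  by (auto simp: rotR_def matrix_vector_mult_def sum_3)

lemma helS_deriv_killing:
  fixes f :: "real^3 \<Rightarrow> real"
  assumes "f differentiable (at x)"
  shows "((\<lambda>\<rho>. f (helS \<sigma> \<rho> x)) has_real_derivative killing \<sigma> f x) (at 0)"
proof -
  have eq: "helS \<sigma> \<rho> x = (cos \<rho> * x $ 1 + sin \<rho> * x $ 2) *\<^sub>R axis 1 1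
      + (- sin \<rho> * x $ 1 + cos \<rho> * x $ 2) *\<^sub>R axis 2 1 + (x $ 3 + \<sigma> * \<rho>) *\<^sub>R axis 3 1" for \<rho>
    by (simp add: vec_eq_iff forall_3 helS_nth axis_def)
  have "((\<lambda>\<rho>. helS \<sigma> \<rho> x) has_derivative
      (\<lambda>s. (s * x $ 2) *\<^sub>R axis 1 1 + (- s * x $ 1) *\<^sub>R axis 2 1 + (\<sigma> * s) *\<^sub>R axis 3 1)) (at 0)"
    unfolding eq by (auto intro!: derivative_eq_intros)
  then have "((\<lambda>\<rho>. f (helS \<sigma> \<rho> x)) has_derivative
      (\<lambda>s. \<Sum>i\<in>UNIV. ((s * x $ 2) *\<^sub>R axis 1 1 + (- s * x $ 1) *\<^sub>R axis 2 1 + (\<sigma> * s) *\<^sub>R axis 3 1) $ i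
        *\<^sub>R partial i f x)) (at 0)"
    by (rule has_derivative_compose) (use has_derivative_partial[OF assms] in simp)
  then show ?thesis
    by (auto simp: has_field_derivative_def killing_def sum_3 axis_def algebra_simps
        elim!: has_derivative_eq_rhs)
qed

lemma helical_group_imp_helical:
  assumes hel: "helical_group \<sigma> v" and diff: "\<And>j x. v j differentiable (at x)"
  shows "helical \<sigma> v"
  unfolding helical_def
proof (intro allI conjI)
  fix x
  note D = helical_groupD[OF hel, THEN fun_cong, of _ x]
  show "killing \<sigma> (v 1) x = v 2 x"
    by (rule DERIV_unique[OF helS_deriv_killing[OF diff]], unfold D)
      (auto intro!: derivative_eq_intros)
  show "killing \<sigma> (v 2) x = - v 1 x"
    by (rule DERIV_unique[OF helS_deriv_killing[OF diff]], unfold D)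
      (auto intro!: derivative_eq_intros)
  show "killing \<sigma> (v 3) x = 0"
    by (rule DERIV_unique[OF helS_deriv_killing[OF diff]], unfold D) simp
qed

text \<open>The axis direction is fixed by every \<open>rotR \<rho>\<close>, so the axial derivative
  commutes with the motions.\<close>

lemma helical_group_partial_3:
  assumes hel: "helical_group \<sigma> v" and diff: "\<And>j x. v j differentiable (at x)"
  shows "helical_group \<sigma> (\<lambda>j. partial 3 (v j))"
  unfolding helical_group_def partial_comp_helS(3)[OF diff, symmetric] helical_groupD[OF hel]
    partial_lincomb[OF diff diff]
  by (intro allI conjI refl)

lemma advection_comp_helS:
  fixes f :: "real^3 \<Rightarrow> real"
  assumes hel: "helical_group \<sigma> v" and "\<And>x. f differentiable (at x)"
  shows "(\<Sum>i\<in>UNIV. v i (helS \<sigma> \<rho> x) * partial i f (helS \<sigma> \<rho> x))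
    = (\<Sum>i\<in>UNIV. v i x * partial i (\<lambda>x. f (helS \<sigma> \<rho> x)) x)"
  unfolding sum_3 helical_groupD[OF hel, THEN fun_cong] partial_comp_helS[OF assms(2)]
  by algebra

lemma constant_of_partials_eq_0:
  fixes f :: "real^3 \<Rightarrow> real"
  assumes "\<And>x. f differentiable (at x)" "\<And>i x. partial i f x = 0"
  shows "f x = f y"
proof -
  have "(f has_derivative (\<lambda>v. 0)) (at x)" for x
    using has_derivative_partial[OF assms(1)] by (simp add: assms(2))
  then show ?thesis
    using has_derivative_zero_unique[of UNIV f x y] by (auto intro: has_derivative_at_withinI)
qed

text \<open>If the gradient is equivariant, P composed with a motion and P have equal gradients and
  differ by a constant depending only on \<rho>. Its derivative at \<rho> = 0 is the common
  value.\<close>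

lemma killing_constant:
  fixes P :: "real^3 \<Rightarrow> real"
  assumes diff: "\<And>x. P differentiable (at x)" and hel: "helical_group \<sigma> (\<lambda>j. partial j P)"
  shows "killing \<sigma> P x = killing \<sigma> P 0"
proof -
  have "partial i (\<lambda>x. P (helS \<sigma> \<rho> x)) x = partial i P x" for i \<rho> x
  proof -
    have sc: "(sin \<rho>)\<^sup>2 + (cos \<rho>)\<^sup>2 = 1" by simp
    have "partial 1 (\<lambda>x. P (helS \<sigma> \<rho> x)) x = partial 1 P x"
      unfolding partial_comp_helS[OF diff] helical_groupD[OF hel, THEN fun_cong] using sc by algebra
    moreover have "partial 2 (\<lambda>x. P (helS \<sigma> \<rho> x)) x = partial 2 P x"
      unfolding partial_comp_helS[OF diff] helical_groupD[OF hel, THEN fun_cong] using sc by algebra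
    moreover have "partial 3 (\<lambda>x. P (helS \<sigma> \<rho> x)) x = partial 3 P x"
      unfolding partial_comp_helS[OF diff] helical_groupD[OF hel, THEN fun_cong] ..
    ultimately show ?thesis using exhaust_3[of i] by auto
  qed
  then have "P (helS \<sigma> \<rho> x) - P x = P (helS \<sigma> \<rho> 0) - P 0" for \<rho>
    using diff comp_helS_differentiable[OF diff]
    by (intro constant_of_partials_eq_0[of "\<lambda>x. P (helS \<sigma> \<rho> x) - P x"])
      (auto simp: partial_diff differentiable_diff)
  then have eq: "P (helS \<sigma> \<rho> x) = P x - P 0 + P (helS \<sigma> \<rho> 0)" for \<rho>
    by (simp add: algebra_simps)
  show ?thesis
    by (rule DERIV_unique[OF helS_deriv_killing[OF diff]], unfold eq)
      (auto intro!: derivative_eq_intros helS_deriv_killing diff)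
qed

text \<open>A half turn reverses the horizontal components, which a constant field leaves
  unchanged.\<close>

lemma helical_constant:
  assumes hel: "helically_symmetric \<sigma> v" and "\<And>x. v x = v 0"
  shows "v x = vector [0, 0, v 0 $ 3]"
proof -
  have "v (helS \<sigma> pi 0) = rotR pi *v v 0"
    by (rule hel[unfolded helically_symmetric_def, rule_format])
  then have eq: "v 0 = rotR pi *v v 0"
    by (rule trans[OF assms(2)[of "helS \<sigma> pi 0", symmetric]])
  have "v 0 $ 1 = - v 0 $ 1" "v 0 $ 2 = - v 0 $ 2"
    by (subst eq, simp add: rotR_def matrix_vector_mult_def sum_3)+
  then have "v 0 $ 1 = 0" "v 0 $ 2 = 0"
    by linarith+
  moreover have "v x = v 0" by (rule assms(2))
  ultimately show ?thesis
    by (simp add: vec_eq_iff forall_3)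
qed

theorem theorem1p1:
  fixes \<sigma> :: real and u h :: "real^3 \<Rightarrow> real^3" and P :: "real^3 \<Rightarrow> real"
  assumes "\<sigma> \<noteq> 0"
    and "smooth u" and "smooth h" and "smooth P"
    and "bounded (range u)" and "bounded (range h)"
    and "\<And>x. - laplacian u x + advect u u x - advect h h x + grad P x = 0"
    and "\<And>x. - laplacian h x + advect u h x - advect h u x = 0"
    and "\<And>x. div3 u x = 0" and "\<And>x. div3 h x = 0"
    and "helically_symmetric \<sigma> u" and "helically_symmetric \<sigma> h"
  shows "\<exists>C1 C2. (\<forall>x. u x = vector [0, 0, C1]) \<and> (\<forall>x. h x = vector [0, 0, C2])"
proof -
  define U where "U = (\<lambda>j x. u x $ j)"
  define H where "H = (\<lambda>j x. h x $ j)"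
  have C2: "Ck (Suc (Suc 0)) (U j)" "Ck (Suc (Suc 0)) (H j)" for j
    using assms(2,3) unfolding smooth_def U_def H_def by (intro Ck_component; blast)+
  have P1: "Ck (Suc 0) P" using assms(4) unfolding smooth_def by blast
  have d: "U j differentiable (at x)" "H j differentiable (at x)" for j x
    using C2 by auto
  have vector: "laplacian v x $ j = laplacian (\<lambda>x. v x $ j) x"
    "advect w v x $ j = (\<Sum>i\<in>UNIV. w x $ i * partial i (\<lambda>x. v x $ j) x)"
    if "smooth v" for v w :: "real^3 \<Rightarrow> real^3" and j x
  proof -
    have "Ck (Suc (Suc 0)) v" using that by (simp only: smooth_def)
    then have dv: "v differentiable (at x)" "partial i v differentiable (at x)" for x i
      by auto
    have "partial i (\<lambda>x. v x $ j) = (\<lambda>x. partial i v x $ j)" for i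
      using dv by (auto simp: partial_component)
    then show "laplacian v x $ j = laplacian (\<lambda>x. v x $ j) x"
      "advect w v x $ j = (\<Sum>i\<in>UNIV. w x $ i * partial i (\<lambda>x. v x $ j) x)"
      unfolding laplacian_def advect_def using dv by (simp_all add: partial_component sum_component)
  qed
  have mom: "partial j P x = laplacian (U j) x - (\<Sum>i\<in>UNIV. U i x * partial i (U j) x)
      + (\<Sum>i\<in>UNIV. H i x * partial i (H j) x)" for j x
  proof -
    have "(- laplacian u x + advect u u x - advect h h x + grad P x) $ j = 0"
      by (simp only: assms(7) zero_index)
    then show ?thesis
      by (simp add: vector[OF assms(2)] vector[OF assms(3)] grad_def U_def H_def)
  qed
  have ind: "laplacian (H j) x = (\<Sum>i\<in>UNIV. U i x * partial i (H j) x)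
      - (\<Sum>i\<in>UNIV. H i x * partial i (U j) x)" for j x
  proof -
    have "(- laplacian h x + advect u h x - advect h u x) $ j = 0"
      by (simp only: assms(8) zero_index)
    then show ?thesis
      by (simp add: vector[OF assms(2)] vector[OF assms(3)] U_def H_def)
  qed
  have grp: "helical_group \<sigma> U" "helical_group \<sigma> H"
    using helical_group_nth assms(11,12) by (auto simp: U_def H_def)
  \<comment> \<open>The momentum equation determines the pressure gradient from the fields. In
    \<open>PS\<close> the motion is shifted entirely onto the differentiated field while the
    advecting one stays at x; the expression is then linear in the moved field, and
    \<open>lin\<close> applies.\<close>
  have "helical_group \<sigma> (\<lambda>j. partial j P)"
  proof -
    have PS: "partial j P (helS \<sigma> \<rho> x) = laplacian (\<lambda>x. U j (helS \<sigma> \<rho> x)) x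
        - (\<Sum>i\<in>UNIV. U i x * partial i (\<lambda>x. U j (helS \<sigma> \<rho> x)) x)
        + (\<Sum>i\<in>UNIV. H i x * partial i (\<lambda>x. H j (helS \<sigma> \<rho> x)) x)" for j \<rho> x
      unfolding mom advection_comp_helS[OF grp(1) d(1)] advection_comp_helS[OF grp(2) d(2)]
        laplacian_comp_helS[OF C2(1)] ..
    have lin: "laplacian (\<lambda>x. p * U j x + q * U k x) x
        - (\<Sum>i\<in>UNIV. U i x * partial i (\<lambda>x. p * U j x + q * U k x) x)
        + (\<Sum>i\<in>UNIV. H i x * partial i (\<lambda>x. p * H j x + q * H k x) x)
        = p * partial j P x + q * partial k P x" for p q j k x
      unfolding laplacian_lincomb[OF C2(1) C2(1)] partial_lincomb[OF d(1) d(1)]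
        partial_lincomb[OF d(2) d(2)] mom sum_3
      by (simp add: algebra_simps)
    show ?thesis
      unfolding helical_group_def PS helical_groupD[OF grp(1)] helical_groupD[OF grp(2)] lin
        mom[symmetric]
      by simp
  qed
  then have K: "killing \<sigma> P x = killing \<sigma> P 0" for x
    using P1 by (intro killing_constant) auto
  obtain b1 b2 where b: "\<And>x. norm (u x) \<le> b1" "\<And>x. norm (h x) \<le> b2"
    using assms(5,6) unfolding bounded_iff by blast
  interpret helical_mhd \<sigma> "max b1 b2" "killing \<sigma> P 0" U H P
  proof
    show "\<bar>U j x\<bar> \<le> max b1 b2" "\<bar>H j x\<bar> \<le> max b1 b2" for j x
      using b(1)[of x] b(2)[of x] component_le_norm_cart[of "u x" j] component_le_norm_cart[of "h x" j]
      by (auto simp: U_def H_def)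
    show "helical \<sigma> U" "helical \<sigma> H" "helical \<sigma> (\<lambda>j. partial 3 (U j))" "helical \<sigma> (\<lambda>j. partial 3 (H j))"
      using C2 by (intro helical_group_imp_helical helical_group_partial_3 grp d; simp)+
    show "divg U x = 0" "divg H x = 0" for x
      using assms(9,10) by (auto simp: divg_def div3_def U_def H_def)
  qed (use assms(1) C2 P1 mom ind K in \<open>auto simp: laplacian_def\<close>)
  have "partial i (U j) x = 0 \<and> partial i (H j) x = 0" for i j x
  proof -
    obtain \<rho> y where y: "y $ 3 = 0" "x = helS \<sigma> \<rho> y"
      using helS_plane[OF assms(1)] by blast
    have *: "partial i (F j) x = 0"
      if F: "helical_group \<sigma> F" and dF: "\<And>j x. F j differentiable (at x)"
        and 0: "\<And>i j. partial i (F j) y = 0" for F i j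
    proof -
      \<comment> \<open>The moved component is a linear combination of components whose gradients
        vanish at y; \<open>partial_helS\<close> then recovers the gradient at x itself.\<close>
      have "partial i (\<lambda>x. F j (helS \<sigma> \<rho> x)) y = 0" for i
      proof -
        consider "j = 1" | "j = 2" | "j = 3" using exhaust_3 by blast
        then show ?thesis
          by cases (simp_all only: helical_groupD[OF F] partial_lincomb[OF dF dF] 0 mult_zero_right add_0)
      qed
      then have "partial 1 (F j) x = 0" "partial 2 (F j) x = 0" "partial 3 (F j) x = 0"
        unfolding y partial_helS[OF dF] by simp_all
      then show ?thesis using exhaust_3[of i] by auto
    qed
    show ?thesis
      using *[OF grp(1) d(1)] *[OF grp(2) d(2)] partials_plane_eq_0[OF y(1)] by blast
  qed
  then have "U j x = U j 0" "H j x = H j 0" for j x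
    by (intro constant_of_partials_eq_0 d; blast)+
  then have "u x = u 0" "h x = h 0" for x
    by (auto simp: vec_eq_iff U_def H_def)
  then show ?thesis
    using helical_constant[OF assms(11)] helical_constant[OF assms(12)] by blast
qed

end
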